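(* Let $X\subseteq\mathbb{R}^n$ be nonempty, closed and convex, let $f_1,\dots,f_m:\mathbb{R}^n\to\mathbb{R}$ be convex, let $f=\sum_{i=1}^m f_i$, and assume that $f^*=\inf_{x\in X}f(x)$ is finite and that the optimal set $X^*=\{x\in X: f(x)=f^*\}$ is nonempty. Assume that for every $i$ there is a constant $C_i$ such that $\|v\|\le C_i$ for every subgradient $v$ of $f_i$ at every point $x\in X$. Let $\{x_k\}$ be generated by the cyclic incremental stochastic subgradient method $$z_{0,k+1}=x_k,\qquad z_{i,k+1}=\mathcal{P}_X\big[z_{i-1,k+1}-\alpha_{k+1}\big(\nabla f_i(z_{i-1,k+1})+\epsilon_{i,k+1}\big)\big]\ (i=1,\dots,m),\qquad x_{k+1}=z_{m,k+1},\qquad k\ge 0,$$ with a random initial vector $x_0\in X$, where the errors satisfy, for deterministic nonnegative sequences $\{\mu_k\}$, $\{\nu_k\}$ and all $i\in\{1,\dots,m\}$, $k\ge1$, $$\big\|\mathsf{E}[\epsilon_{i,k}\mid F_k^{i-1}]\big\|\le\mu_k,\qquad \mathsf{E}\big[\|\epsilon_{i,k}\|^2\mid F_k^{i-1}\big]\le\nu_k^2 .$$ Assume that the step-sizes are positive with $\sum_{k=1}^\infty\alpha_k=\infty$ and $\sum_{k=1}^\infty\alpha_k^2<\infty$, and that $$\sum_{k=1}^\infty\alpha_k\mu_k<\infty,\qquad \sum_{k=1}^\infty\alpha_k^2\nu_k^2<\infty .$$ Then, with probability 1, the sequence $\{x_k\}$ converges to an optimal solution, i.e. to a (random) point of $X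^*$.
   Context: $\|\cdot\|$ is the Euclidean norm and $\mathcal{P}_X$ is the Euclidean projection onto $X$. A vector $v$ is a subgradient of a convex function $g:\mathbb{R}^n\to\mathbb{R}$ at $x$ if $v^T(y-x)\le g(y)-g(x)$ for all $y\in\mathbb{R}^n$; $\nabla f_i(x)$ denotes a (chosen) subgradient of $f_i$ at $x$. The step-sizes $\alpha_k$, $k\ge1$, are deterministic. All random quantities live on one probability space; $F_k^i$ is the $\sigma$-algebra generated by $x_0$ and the errors $\epsilon_{1,1},\dots,\epsilon_{i,k}$ in order of occurrence (all errors of cycles $1,\dots,k-1$ and the errors $\epsilon_{1,k},\dots,\epsilon_{i,k}$ of cycle $k$), with $F_k^0=F_{k-1}^m$ and $F_0^m=\sigma(x_0)$. The subgradients are selected so that $z_{i,k}$ is $F_k^i$-measurable. *)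

theory Defs
  imports "HOL-Probability.Probability"
begin

definition is_subgradient :: "(real^'n \<Rightarrow> real) \<Rightarrow> real^'n \<Rightarrow> real^'n \<Rightarrow> bool" where
  "is_subgradient g x v \<longleftrightarrow> (\<forall>y. v \<bullet> (y - x) \<le> g y - g x)"

definition optimal_set :: "(real^'n) set \<Rightarrow> (real^'n \<Rightarrow> real) \<Rightarrow> (real^'n) set" where
  "optimal_set X g = {x \<in> X. g x = (INF y\<in>X. g y)}"

text \<open>The library has conditional expectations of real functions only; for random vectors they
  are taken componentwise.\<close>

definition vec_cond_exp ::
    "'w measure \<Rightarrow> 'w measure \<Rightarrow> ('w \<Rightarrow> real^'n) \<Rightarrow> 'w \<Rightarrow> real^'n" where
  "vec_cond_exp M F Y \<omega> = (\<chi> j. real_cond_exp M F (\<lambda>\<omega>'. Y \<omega>' $ j) \<omega>)"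

text \<open>\<open>history M m x0 err i k\<close> is the \<open>\<sigma>\<close>-algebra usually written \<open>F\<^sub>k\<^sup>i\<close>, where \<open>err j l\<close> is the
  \<open>j\<close>-th error (\<open>1 \<le> j \<le> m\<close>) of cycle \<open>l \<ge> 1\<close>. The conventions for \<open>i = 0\<close> and for cycle \<open>0\<close> are
  consequences of the definition; see the two lemmas below.\<close>

definition history ::
    "'w measure \<Rightarrow> nat \<Rightarrow> ('w \<Rightarrow> real^'n) \<Rightarrow> (nat \<Rightarrow> nat \<Rightarrow> 'w \<Rightarrow> real^'n) \<Rightarrow> nat \<Rightarrow> nat \<Rightarrow> 'w measure"
  where
  "history M m x0 err i k = sigma (space M)
     ({x0 -` A \<inter> space M | A. A \<in> sets borel} \<union>
      {err j l -` A \<inter> space M | j l A. A \<in> sets borel \<and> 1 \<le> j \<and> 1 \<le> l \<and>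
         (l < k \<and> j \<le> m \<or> l = k \<and> j \<le> i)})"

lemma history_Suc_0: "history M m x0 err 0 (Suc k) = history M m x0 err m k"
proof -
  have "(l < Suc k \<and> j \<le> m \<or> l = Suc k \<and> j \<le> 0) \<longleftrightarrow> (l < k \<and> j \<le> m \<or> l = k \<and> j \<le> m)"
    if "1 \<le> j" for j l
    using that by auto
  then show ?thesis
    unfolding history_def by (intro arg_cong2[where f = sigma] arg_cong2[where f = "(\<union>)"] refl) blast
qed

lemma history_cycle_0: "history M m x0 err i 0 = vimage_algebra (space M) x0 borel"
proof -
  have "{err j l -` A \<inter> space M | j l A. A \<in> sets borel \<and> 1 \<le> j \<and> 1 \<le> l \<and>
         (l < 0 \<and> j \<le> m \<or> l = 0 \<and> j \<le> i)} = {}"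
    by auto
  then show ?thesis
    unfolding history_def vimage_algebra_def by simp
qed

end

theory Submission imports Defs
begin

text \<open>
  Over one cycle, for every \<open>y \<in> X\<close>, the squared distance to \<open>y\<close> changes by at most
  \<open>- 2\<alpha> (f(x\<^sub>k) - f(y)) - 2\<alpha> (\<Sum>i. \<epsilon>\<^sub>i \<bullet> (x\<^sub>k - y))\<close> plus a remainder of order
  \<open>\<alpha>\<^sup>2 (1 + (\<Sum>i. \<parallel>\<epsilon>\<^sub>i\<parallel>\<^sup>2))\<close> (\<open>incremental_cycle_descent\<close>). All errors of the cycle are paired with the vector
  \<open>x\<^sub>k - y\<close> known at the start of the cycle; the drift within the cycle is part of the remainder.

  If, along a trajectory, the remainders and the noise terms form convergent series for every optimal
  \<open>y\<close>, then a purely deterministic argument applies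
  (\<open>quasi_fejer_converges_to_optimal\<close>): distances to optimal points converge, the optimality gap
  has lower limit \<open>0\<close> because the step-sizes are not summable, and a cluster point of a subsequence
  along which the gap vanishes is the limit of the whole trajectory.

  It remains to see that these series converge almost surely. The remainders are nonnegative with
  summable expectations. The noise series \<open>\<Sum>k. \<alpha>\<^sub>k (\<epsilon>\<^bsub>i,k\<^esub> \<bullet> Y\<^sub>k)\<close>, with \<open>Y\<^sub>k\<close> known before \<open>\<epsilon>\<^bsub>i,k\<^esub>\<close>
  and bounded in mean square, splits into conditional means, which are dominated by
  \<open>\<alpha>\<^sub>k \<mu>\<^sub>k \<parallel>Y\<^sub>k\<parallel>\<close>, and the increments of a square-integrable martingale with summable variances
  (\<open>weighted_noise_series_converges\<close>). The latter converges by the maximal inequality for stopped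
  partial sums (\<open>L2_martingale_converges\<close>), which takes the place of a supermartingale convergence theorem. The
  noise lemma is used for \<open>Y\<^sub>k = x\<^sub>k - y\<^sub>0\<close> with one fixed optimal \<open>y\<^sub>0\<close>, restricted to the event that \<open>x\<^sub>0\<close> is
  bounded by \<open>R\<close>, and for the unit vectors; together they cover every \<open>y\<close> simultaneously. The
  mean square bound on the restricted \<open>x\<^sub>k - y\<^sub>0\<close> comes from taking expectations in the one-cycle
  inequality and the discrete Gronwall lemma.
\<close>

section \<open>Subgradients of convex functions\<close>

text \<open>The strict epigraph of \<open>g\<close> is convex and misses the point \<open>(x, g x)\<close>, so a hyperplane with some
  normal \<open>(a, t)\<close> separates them. It cannot be vertical because \<open>g\<close> is finite
  everywhere, and dividing \<open>a\<close> by \<open>-t\<close> gives the slope of a supporting affine function.\<close>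

lemma convex_on_UNIV_has_subgradient:
  fixes g :: "real^'n \<Rightarrow> real"
  assumes "convex_on UNIV g"
  shows "\<exists>v. is_subgradient g x v"
proof -
  define S where "S = {p. g (fst p) < snd p}"
  have "convex S"
    unfolding convex_def
  proof (intro ballI allI impI)
    fix p q u v assume *: "p \<in> S" "q \<in> S" "0 \<le> u" "0 \<le> v" "u + v = (1::real)"
    have "g (u *\<^sub>R fst p + v *\<^sub>R fst q) \<le> u * g (fst p) + v * g (fst q)"
      using assms * unfolding convex_on_def by auto
    also have "\<dots> < u * snd p + v * snd q"
    proof (cases "u = 0")
      case True then show ?thesis using * by (auto simp: S_def)
    next
      case False
      then have "u * g (fst p) < u * snd p" using * by (auto simp: S_def)
      moreover have "v * g (fst q) \<le> v * snd q" using * by (auto simp: S_def intro!: mult_left_mono)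
      ultimately show ?thesis by simp
    qed
    finally show "u *\<^sub>R p + v *\<^sub>R q \<in> S" by (simp add: S_def)
  qed
  moreover have "S \<noteq> {}" using lt_ex[of "g x"] gt_ex[of "g x"] by (auto simp: S_def)
  moreover have "S \<inter> {(x, g x)} = {}" by (auto simp: S_def)
  ultimately obtain c b where cb: "c \<noteq> 0" "\<forall>p\<in>S. c \<bullet> p \<le> b" "\<forall>p\<in>{(x, g x)}. b \<le> c \<bullet> p"
    using separating_hyperplane_sets[of S "{(x, g x)}"] by auto
  obtain a t where c: "c = (a, t)" by (cases c)
  have sep: "a \<bullet> y + t * r \<le> a \<bullet> x + t * g x" if "g y < r" for y r
  proof -
    have "(y, r) \<in> S" using that by (simp add: S_def)
    with cb show ?thesis by (fastforce simp: c inner_prod_def)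
  qed
  have "t \<le> 0"
    using sep[of x "g x + 1"] by (simp add: algebra_simps)
  moreover have "t \<noteq> 0"
  proof
    assume "t = 0"
    then have "a \<bullet> y \<le> a \<bullet> x" for y using sep[of y "g y + 1"] by simp
    from this[of "x + a"] have "a \<bullet> a \<le> 0" by (simp add: inner_add_right)
    then have "a = 0" using inner_ge_zero[of a] inner_eq_zero_iff[of a] by linarith
    with \<open>t = 0\<close> c cb(1) show False by (simp add: zero_prod_def)
  qed
  ultimately have t: "t < 0" by simp
  \<comment> \<open>The epigraph is strict, so the height \<open>g y\<close> is reached only as a limit of \<open>g y + e / - t\<close>.\<close>
  have "is_subgradient g x ((- 1 / t) *\<^sub>R a)"
    unfolding is_subgradient_def
  proof (intro allI)
    fix y
    have "a \<bullet> (y - x) \<le> (- t) * (g y - g x)"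
    proof (rule field_le_epsilon)
      fix e :: real assume "0 < e"
      have "a \<bullet> y + t * (g y + e / (-t)) \<le> a \<bullet> x + t * g x"
        using t \<open>0 < e\<close> by (intro sep) (simp add: divide_pos_neg)
      then show "a \<bullet> (y - x) \<le> - t * (g y - g x) + e"
        using t by (simp add: algebra_simps)
    qed
    then show "((- 1 / t) *\<^sub>R a) \<bullet> (y - x) \<le> g y - g x"
      using t by (simp add: field_simps)
  qed
  then show ?thesis by blast
qed

text \<open>An upper bound for \<open>g x - g y\<close> comes from a subgradient at \<open>x\<close>. In the method \<open>x\<close> is the start of a
  cycle, where a subgradient of \<open>f\<^sub>1\<close> alone is computed; this is why existence of subgradients matters.\<close>

lemma convex_diff_le_of_subgradient_bound:
  fixes g :: "real^'n \<Rightarrow> real"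
  assumes "convex_on UNIV g" and "\<And>v. is_subgradient g x v \<Longrightarrow> norm v \<le> C"
  shows "g x - g y \<le> C * norm (y - x)"
proof -
  obtain v where v: "is_subgradient g x v"
    using convex_on_UNIV_has_subgradient[OF assms(1)] by blast
  then have "v \<bullet> (y - x) \<le> g y - g x" by (simp add: is_subgradient_def)
  moreover have "- (norm v * norm (y - x)) \<le> v \<bullet> (y - x)"
    using Cauchy_Schwarz_ineq2[of v "y - x"] by linarith
  moreover have "norm v * norm (y - x) \<le> C * norm (y - x)"
    using assms(2)[OF v] by (simp add: mult_right_mono)
  ultimately show ?thesis by linarith
qed

section \<open>One cycle of the incremental method\<close>

text \<open>Both estimates on a projected step express the nonexpansiveness of the projection, compared
  with a point of \<open>X\<close>, which the projection fixes.\<close>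

lemma norm_projected_step_le:
  fixes X :: "(real^'n) set"
  assumes X: "X \<noteq> {}" "closed X" "convex X" and y: "y \<in> X"
  shows "norm (closest_point X (u - d) - y) \<le> norm (u - d - y)"
  using closest_point_lipschitz[OF X(3,2,1), of "u - d" y] closest_point_self[OF y]
  by (simp add: dist_norm)

lemma norm_projected_step_sq_le:
  fixes X :: "(real^'n) set"
  assumes X: "X \<noteq> {}" "closed X" "convex X" and y: "y \<in> X"
  shows "norm (closest_point X (u - d) - y)^2 \<le> norm (u - y)^2 - 2 * (d \<bullet> (u - y)) + (norm d)^2"
proof -
  have "norm (closest_point X (u - d) - y)^2 \<le> norm (u - d - y)^2"
    by (intro power_mono norm_projected_step_le X y) simp
  also have "u - d - y = (u - y) - d" by simp
  also have "norm ((u - y) - d)^2 = norm (u - y)^2 - 2 * (d \<bullet> (u - y)) + (norm d)^2"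
    by (simp add: power2_norm_eq_inner inner_diff_left inner_diff_right inner_commute algebra_simps)
  finally show ?thesis .
qed

text \<open>Expanding the squared distances along the cycle gives terms evaluated at the moving points
  \<open>z (i - 1)\<close>. Each step has length at most \<open>a (C + \<parallel>e i\<parallel>)\<close>, so all these points stay within
  \<open>a s\<close> of \<open>z 0\<close>, where \<open>s = (\<Sum>i. C + \<parallel>e i\<parallel>)\<close>, and replacing them by \<open>z 0\<close> costs only terms of
  order \<open>a\<^sup>2 s\<^sup>2\<close>. The point of doing so also in the inner products with the errors is that \<open>z 0\<close> is
  known before any error of the cycle occurs.\<close>

lemma incremental_cycle_descent:
  fixes X :: "(real^'n) set" and z g e :: "nat \<Rightarrow> real^'n"
  assumes X: "X \<noteq> {}" "closed X" "convex X" and y: "y \<in> X"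
    and conv: "\<And>i. i \<in> {1..m} \<Longrightarrow> convex_on UNIV (f i)"
    and bound: "\<And>i u v. i \<in> {1..m} \<Longrightarrow> u \<in> X \<Longrightarrow> is_subgradient (f i) u v \<Longrightarrow> norm v \<le> C"
    and C: "0 \<le> C" and a: "0 \<le> a"
    and z0: "z 0 \<in> X"
    and g: "\<And>i. i \<in> {1..m} \<Longrightarrow> is_subgradient (f i) (z (i - 1)) (g i)"
    and step: "\<And>i. i \<in> {1..m} \<Longrightarrow> z i = closest_point X (z (i - 1) - a *\<^sub>R (g i + e i))"
  shows "norm (z m - y)^2 \<le> norm (z 0 - y)^2
      - 2 * a * ((\<Sum>i=1..m. f i (z 0)) - (\<Sum>i=1..m. f i y))
      - 2 * a * (\<Sum>i=1..m. e i \<bullet> (z 0 - y))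
      + 3 * a^2 * (\<Sum>i=1..m. C + norm (e i))^2"
proof -
  define r where "r i = C + norm (e i)" for i
  define s where "s = (\<Sum>i=1..m. r i)"
  have r0: "0 \<le> r i" for i using C by (simp add: r_def)
  have s0: "0 \<le> s" by (simp add: s_def sum_nonneg r0)
  have zX: "z i \<in> X" if "i \<le> m" for i
  proof (cases i)
    case (Suc j)
    then show ?thesis using that step[of i] closest_point_in_set[OF X(2,1)] by simp
  qed (use z0 in simp)
  have ge: "norm (g i + e i) \<le> r i" if "i \<in> {1..m}" for i
  proof -
    have "norm (g i) \<le> C"
      using that by (intro bound[OF that zX[of "i - 1"] g[OF that]]) auto
    then show ?thesis unfolding r_def using norm_triangle_ineq[of "g i" "e i"] by linarith
  qed
  have drift: "norm (z i - z 0) \<le> a * (\<Sum>j=1..i. r j)" if "i \<le> m" for i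
    using that
  proof (induction i)
    case (Suc i)
    then have i: "Suc i \<in> {1..m}" by simp
    have "norm (z (Suc i) - z i) \<le> norm (a *\<^sub>R (g (Suc i) + e (Suc i)))"
      using norm_projected_step_le[OF X zX[of i], of "z i" "a *\<^sub>R (g (Suc i) + e (Suc i))"] Suc.prems
      unfolding step[OF i] by simp
    also have "\<dots> \<le> a * r (Suc i)"
      using ge[OF i] a by (simp add: mult_left_mono)
    finally show ?case
      using Suc norm_triangle_ineq[of "z (Suc i) - z i" "z i - z 0"] by (simp add: algebra_simps)
  qed simp
  have drift': "norm (z i - z 0) \<le> a * s" if "i \<le> m" for i
  proof -
    have "(\<Sum>j=1..i. r j) \<le> s" unfolding s_def using that by (intro sum_mono2) (auto simp: r0)
    then show ?thesis using drift[OF that] a by (meson mult_left_mono order_trans)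
  qed
  have one: "norm (z i - y)^2 \<le> norm (z (i - 1) - y)^2 + (- 2 * a * (f i (z 0) - f i y)
      - 2 * a * (e i \<bullet> (z 0 - y)) + 2 * a^2 * s * r i + a^2 * (r i)^2)"
    if i: "i \<in> {1..m}" for i
  proof -
    have i': "i - 1 \<le> m" using i by auto
    let ?w = "z (i - 1)"
    have "norm (z i - y)^2 \<le> norm (?w - y)^2 - 2 * ((a *\<^sub>R (g i + e i)) \<bullet> (?w - y)) + (norm (a *\<^sub>R (g i + e i)))^2"
      unfolding step[OF i] by (rule norm_projected_step_sq_le[OF X y])
    moreover have "(norm (a *\<^sub>R (g i + e i)))^2 \<le> a^2 * (r i)^2"
      using ge[OF i] a by (simp add: power_mult_distrib mult_left_mono power_mono)
    moreover have "a * (f i (z 0) - f i y - C * (a * s) + e i \<bullet> (z 0 - y) - norm (e i) * (a * s))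
         \<le> a * ((g i + e i) \<bullet> (?w - y))"
    proof (intro mult_left_mono a)
      have "g i \<bullet> (y - ?w) \<le> f i y - f i ?w"
        using g[OF i] by (simp add: is_subgradient_def)
      then have "f i ?w - f i y \<le> g i \<bullet> (?w - y)"
        by (simp add: inner_diff_right)
      moreover have "f i (z 0) - f i ?w \<le> C * norm (?w - z 0)"
        by (intro convex_diff_le_of_subgradient_bound conv[OF i] bound[OF i z0])
      moreover have "C * norm (?w - z 0) \<le> C * (a * s)"
        by (intro mult_left_mono drift' i' C)
      moreover have "e i \<bullet> (z 0 - y) - norm (e i) * (a * s) \<le> e i \<bullet> (?w - y)"
      proof -
        have "- (norm (e i) * norm (?w - z 0)) \<le> e i \<bullet> (?w - z 0)"
          using Cauchy_Schwarz_ineq2[of "e i" "?w - z 0"] by linarith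
        moreover have "norm (e i) * norm (?w - z 0) \<le> norm (e i) * (a * s)"
          by (intro mult_left_mono drift' i') simp
        moreover have "e i \<bullet> (?w - y) = e i \<bullet> (z 0 - y) + e i \<bullet> (?w - z 0)"
          by (simp add: inner_diff_right)
        ultimately show ?thesis by linarith
      qed
      ultimately show "f i (z 0) - f i y - C * (a * s) + e i \<bullet> (z 0 - y) - norm (e i) * (a * s)
          \<le> (g i + e i) \<bullet> (?w - y)"
        by (simp add: inner_add_left)
    qed
    moreover have "2 * a * (f i (z 0) - f i y) + 2 * a * (e i \<bullet> (z 0 - y)) - 2 * a^2 * s * r i
      = 2 * (a * (f i (z 0) - f i y - C * (a * s) + e i \<bullet> (z 0 - y) - norm (e i) * (a * s)))"
      by (simp add: r_def algebra_simps power2_eq_square)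
    ultimately show ?thesis by simp
  qed
  have "norm (z k - y)^2 \<le> norm (z 0 - y)^2 + (\<Sum>i=1..k. - 2 * a * (f i (z 0) - f i y)
      - 2 * a * (e i \<bullet> (z 0 - y)) + 2 * a^2 * s * r i + a^2 * (r i)^2)" if "k \<le> m" for k
    using that
  proof (induction k)
    case (Suc k)
    then show ?case using one[of "Suc k"] by simp
  qed simp
  from this[OF order_refl] have "norm (z m - y)^2 \<le> norm (z 0 - y)^2 
      - 2 * a * ((\<Sum>i=1..m. f i (z 0)) - (\<Sum>i=1..m. f i y))
      - 2 * a * (\<Sum>i=1..m. e i \<bullet> (z 0 - y)) + 2 * a^2 * s * s + a^2 * (\<Sum>i=1..m. (r i)^2)"
    unfolding s_def
    by (simp add: sum.distrib sum_subtractf sum_distrib_left right_diff_distrib sum_negf algebra_simps)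
  moreover have "a^2 * (\<Sum>i=1..m. (r i)^2) \<le> a^2 * s^2"
  proof (intro mult_left_mono)
    have "(\<Sum>i=1..m. (r i)^2) \<le> (\<Sum>i=1..m. r i * s)"
      unfolding power2_eq_square s_def
      by (intro sum_mono mult_left_mono r0 member_le_sum) (auto simp: r0)
    then show "(\<Sum>i=1..m. (r i)^2) \<le> s^2"
      by (simp add: s_def power2_eq_square sum_distrib_right)
  qed simp
  ultimately show ?thesis by (simp add: r_def s_def power2_eq_square algebra_simps)
qed

section \<open>Convergence of a single trajectory\<close>

text \<open>The perturbations \<open>c\<close> may have either sign and the series may converge only conditionally: subtracting
  its partial sums from \<open>a\<close> leaves a decreasing sequence that is bounded below.\<close>

lemma almost_decreasing_convergent:
  fixes a g c :: "nat \<Rightarrow> real"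
  assumes step: "\<And>k. a (Suc k) \<le> a k - g k + c k"
    and a: "\<And>k. 0 \<le> a k" and g: "\<And>k. 0 \<le> g k" and c: "summable c"
  shows "convergent a" "summable g"
proof -
  define u where "u k = a k - (\<Sum>j<k. c j)" for k
  obtain K where K: "\<And>k. \<bar>\<Sum>j<k. c j\<bar> \<le> K"
    using convergent_imp_Bseq[OF c[unfolded summable_iff_convergent]] unfolding Bseq_def by auto
  have tel: "u k + (\<Sum>j<k. g j) \<le> u 0" for k
  proof (induction k)
    case (Suc k)
    then show ?case using step[of k] by (simp add: u_def)
  qed simp
  have lower: "- K \<le> u k" for k using K[of k] a[of k] by (simp add: u_def)
  have "decseq u"
  proof (rule decseq_SucI)
    show "u (Suc k) \<le> u k" for k using step[of k] g[of k] by (simp add: u_def)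
  qed
  then have "convergent u"
    using lower decseq_convergent[of u "- K"] unfolding convergent_def by metis
  moreover have "a = (\<lambda>k. u k + (\<Sum>j<k. c j))" by (simp add: u_def)
  ultimately show "convergent a"
    using c unfolding summable_iff_convergent by (simp only: convergent_add)
  show "summable g"
  proof (rule summableI_nonneg_bounded[where x = "u 0 + K"])
    show "0 \<le> g k" for k by (rule g)
    show "sum g {..<k} \<le> u 0 + K" for k using tel[of k] lower[of k] by simp
  qed
qed

text \<open>The distances to every optimal point converge, and the weighted optimality gaps are summable.
  As the weights are not summable, the gaps come arbitrarily close to \<open>0\<close>; by boundedness some
  subsequence then converges to a point \<open>p\<close>, which is optimal by continuity. The distance to
  this particular \<open>p\<close> converges and has the limit \<open>0\<close> along the subsequence, so it tends to \<open>0\<close>.\<close>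

lemma quasi_fejer_converges_to_optimal:
  fixes x :: "nat \<Rightarrow> real^'n" and F :: "real^'n \<Rightarrow> real"
  assumes X: "closed X" and xX: "\<And>k. x k \<in> X"
    and F: "continuous_on UNIV F" and bdd: "bdd_below (F ` X)"
    and opt: "optimal_set X F \<noteq> {}"
    and b: "\<And>k. 0 < b k" and b_sum: "\<not> summable b"
    and step: "\<And>k y. y \<in> optimal_set X F \<Longrightarrow>
        norm (x (Suc k) - y)^2 \<le> norm (x k - y)^2 - b k * (F (x k) - F y) + c y k"
    and c: "\<And>y. y \<in> optimal_set X F \<Longrightarrow> summable (c y)"
  shows "\<exists>p\<in>optimal_set X F. x \<longlonglongrightarrow> p"
proof -
  define F0 where "F0 = (INF y\<in>X. F y)"
  have F0: "F0 \<le> F u" if "u \<in> X" for u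
    unfolding F0_def using bdd that by (rule cINF_lower)
  have Fopt: "F y = F0" if "y \<in> optimal_set X F" for y
    using that by (simp add: optimal_set_def F0_def)
  obtain y0 where y0: "y0 \<in> optimal_set X F" using opt by blast
  have nonneg: "0 \<le> b k * (F (x k) - F y)" if "y \<in> optimal_set X F" for k y
    using b[of k] F0[OF xX[of k]] Fopt[OF that] by simp
  have dist_conv: "convergent (\<lambda>k. norm (x k - y)^2)" if "y \<in> optimal_set X F" for y
    by (rule almost_decreasing_convergent(1)[OF step[OF that] _ nonneg[OF that] c[OF that]]) simp
  have gap: "summable (\<lambda>k. b k * (F (x k) - F y0))"
    by (rule almost_decreasing_convergent(2)[OF step[OF y0] _ nonneg[OF y0] c[OF y0]]) simp
  have "\<exists>k\<ge>n. F (x k) < F0 + \<epsilon>" if "0 < \<epsilon>" for n :: nat and \<epsilon>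
  proof (rule ccontr)
    assume "\<not> ?thesis"
    then have "norm (b k) \<le> b k * (F (x k) - F y0) / \<epsilon>" if "n \<le> k" for k
      using that b[of k] \<open>0 < \<epsilon>\<close> Fopt[OF y0]
      by (auto simp: not_less pos_le_divide_eq intro!: mult_left_mono)
    then have "summable b"
      by (intro summable_comparison_test'[OF summable_divide[OF gap, of \<epsilon>]])
    with b_sum show False ..
  qed
  then have "\<exists>k\<ge>n. F (x k) < F0 + 1 / Suc n" for n by simp
  then obtain \<kappa> where \<kappa>: "\<And>n. n \<le> \<kappa> n" "\<And>n. F (x (\<kappa> n)) < F0 + 1 / Suc n" by metis
  have \<kappa>_lim: "filterlim \<kappa> at_top sequentially"
    by (rule filterlim_at_top_mono[OF filterlim_ident]) (simp add: \<kappa>)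
  obtain K where K: "\<And>k. norm (norm (x k - y0)^2) \<le> K"
    using convergent_imp_Bseq[OF dist_conv[OF y0]] unfolding Bseq_def by auto
  have "bounded (range (x \<circ> \<kappa>))"
  proof (rule bounded_subset[OF bounded_cball])
    show "range (x \<circ> \<kappa>) \<subseteq> cball y0 (sqrt K)"
      using K by (auto simp: dist_norm norm_minus_commute intro!: real_le_rsqrt)
  qed
  then obtain p r where r: "strict_mono (r :: nat \<Rightarrow> nat)" and p: "((x \<circ> \<kappa>) \<circ> r) \<longlonglongrightarrow> p"
    using bounded_imp_convergent_subsequence by blast
  have p': "(\<lambda>n. x (\<kappa> (r n))) \<longlonglongrightarrow> p" using p by (simp add: comp_def)
  have pX: "p \<in> X" using closed_sequentially[OF X _ p'] xX by blast
  have "(\<lambda>n. F (x (\<kappa> (r n)))) \<longlonglongrightarrow> F p"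
    using F p' by (intro isCont_tendsto_compose[of p F]) (auto simp: continuous_on_eq_continuous_at)
  moreover have "(\<lambda>n. F0 + 1 / Suc (r n)) \<longlonglongrightarrow> F0 + 0"
    using LIMSEQ_subseq_LIMSEQ[OF LIMSEQ_Suc[OF lim_1_over_n] r] 
    by (intro tendsto_add tendsto_const) (simp add: comp_def)
  ultimately have "F p \<le> F0 + 0"
    by (rule LIMSEQ_le) (use \<kappa>(2) in \<open>auto intro!: exI[of _ 0] less_imp_le\<close>)
  with F0[OF pX] pX have opt_p: "p \<in> optimal_set X F" by (simp add: optimal_set_def F0_def)
  obtain L where L: "(\<lambda>k. norm (x k - p)^2) \<longlonglongrightarrow> L"
    using dist_conv[OF opt_p] by (auto simp: convergent_def)
  have "(\<lambda>n. norm (x (\<kappa> (r n)) - p)^2) \<longlonglongrightarrow> L"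
    using filterlim_compose[OF L filterlim_compose[OF \<kappa>_lim filterlim_subseq[OF r]]] .
  moreover have "(\<lambda>n. norm (x (\<kappa> (r n)) - p)^2) \<longlonglongrightarrow> norm (p - p)^2"
    by (intro tendsto_intros p')
  ultimately have "L = norm (p - p)^2" by (rule LIMSEQ_unique)
  then have "L = 0" by simp
  with L have "(\<lambda>k. sqrt (norm (x k - p)^2)) \<longlonglongrightarrow> sqrt 0" by (intro tendsto_real_sqrt) simp
  then have "(\<lambda>k. norm (x k - p)) \<longlonglongrightarrow> 0"
    by (simp only: real_sqrt_pow2_iff real_sqrt_abs abs_norm_cancel real_sqrt_zero)
  then have "x \<longlonglongrightarrow> p" by (rule LIM_zero_cancel[OF tendsto_norm_zero_cancel])
  with opt_p show ?thesis by blast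
qed

section \<open>Almost sure convergence of noise series\<close>

lemma le_one_plus_square: "t \<le> 1 + t\<^sup>2" for t :: real
  using zero_le_power2[of "t - 1"] zero_le_power2[of t] unfolding power2_diff one_power2 by linarith

lemma discrete_gronwall_bounded:
  fixes a p q :: "nat \<Rightarrow> real"
  assumes step: "\<And>k. a (Suc k) \<le> (1 + p k) * a k + q k"
    and a: "\<And>k. 0 \<le> a k" and p: "\<And>k. 0 \<le> p k" "summable p" and q: "\<And>k. 0 \<le> q k" "summable q"
  shows "\<exists>B. \<forall>k. a k \<le> B"
proof -
  have main: "a k \<le> exp (\<Sum>j<k. p j) * (a 0 + (\<Sum>j<k. q j))" for k
  proof (induction k)
    case (Suc k)
    let ?P = "\<Sum>j<k. p j" and ?Q = "a 0 + (\<Sum>j<k. q j)"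
    have "a (Suc k) \<le> (1 + p k) * (exp ?P * ?Q) + q k"
      using step[of k] mult_left_mono[OF Suc, of "1 + p k"] p(1)[of k] by linarith
    also have "\<dots> \<le> exp (p k) * (exp ?P * ?Q) + exp (p k) * exp ?P * q k"
    proof (intro add_mono mult_right_mono)
      show "1 + p k \<le> exp (p k)" by (rule exp_ge_add_one_self)
      show "0 \<le> exp ?P * ?Q" by (intro mult_nonneg_nonneg add_nonneg_nonneg a sum_nonneg q) simp
      have "1 * q k \<le> exp (p k + ?P) * q k"
        by (intro mult_right_mono q) (simp add: p sum_nonneg)
      then show "q k \<le> exp (p k) * exp ?P * q k" by (simp add: exp_add)
    qed
    finally show ?case by (simp add: exp_add algebra_simps)
  qed simp
  have "a k \<le> exp (suminf p) * (a 0 + suminf q)" for k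
  proof -
    have "exp (\<Sum>j<k. p j) * (a 0 + (\<Sum>j<k. q j)) \<le> exp (suminf p) * (a 0 + suminf q)"
      by (intro mult_mono add_left_mono)
         (auto intro!: sum_le_suminf p q add_nonneg_nonneg a sum_nonneg)
    with main[of k] show ?thesis by linarith
  qed
  then show ?thesis by blast
qed

text \<open>Stop the partial sums at the first time they leave \<open>(-\<epsilon>, \<epsilon>)\<close>: the stopped value at time \<open>n\<close> still
  records whether the level \<open>\<epsilon>\<close> was ever reached, and by orthogonality its second moment is at most
  the sum of the second moments of the increments, so Chebyshev's inequality applies.
  Testing the increments only against bounded functions suffices because the stopped sum is smaller
  than \<open>\<epsilon>\<close> in absolute value as long as it still moves.\<close>

lemma L2_martingale_maximal_inequality:
  fixes d :: "nat \<Rightarrow> 'w \<Rightarrow> real" and F :: "nat \<Rightarrow> 'w measure"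
  assumes M: "prob_space M"
    and sub: "\<And>k. subalgebra M (F k)" and mono: "\<And>k. sets (F k) \<subseteq> sets (F (Suc k))"
    and d_meas: "\<And>k. d k \<in> borel_measurable (F (Suc k))"
    and d_sq: "\<And>k. integrable M (\<lambda>\<omega>. (d k \<omega>)\<^sup>2)"
    and orth: "\<And>k B c. B \<in> borel_measurable (F k) \<Longrightarrow> (\<And>\<omega>. \<bar>B \<omega>\<bar> \<le> c) \<Longrightarrow>
      (\<integral>\<omega>. B \<omega> * d k \<omega> \<partial>M) = 0"
    and \<epsilon>: "0 < \<epsilon>"
  shows "measure M {\<omega>\<in>space M. \<exists>j\<le>n. \<epsilon> \<le> \<bar>\<Sum>k<j. d k \<omega>\<bar>} \<le> (\<Sum>k<n. \<integral>\<omega>. (d k \<omega>)\<^sup>2 \<partial>M) / \<epsilon>\<^sup>2"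
proof -
  interpret prob_space M by (rule M)
  \<comment> \<open>\<open>t\<close> is the stopped sequence of partial sums.\<close>
  define t where "t = rec_nat (\<lambda>\<omega>. 0) (\<lambda>k s \<omega>. if \<bar>s \<omega>\<bar> < \<epsilon> then s \<omega> + d k \<omega> else s \<omega>)"
  have t0: "t 0 = (\<lambda>\<omega>. 0)" by (simp add: t_def)
  have tS: "t (Suc k) = (\<lambda>\<omega>. if \<bar>t k \<omega>\<bar> < \<epsilon> then t k \<omega> + d k \<omega> else t k \<omega>)" for k
    by (rule ext) (simp add: t_def)
  have up: "g \<in> borel_measurable (F (Suc k))" if "g \<in> borel_measurable (F k)" for g :: "'w \<Rightarrow> real" and k
    using that sub mono by (intro measurable_from_subalg[of "F (Suc k)" "F k"]) (auto simp: subalgebra_def)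
  have t_meas: "t k \<in> borel_measurable (F k)" for k
  proof (induction k)
    case (Suc k)
    note [measurable] = up[OF Suc] d_meas[of k]
    show ?case unfolding tS by measurable
  qed (simp add: t0)
  have t_measM[measurable]: "t k \<in> borel_measurable M" for k
    by (rule measurable_from_subalg[OF sub t_meas])
  have d_measM[measurable]: "d k \<in> borel_measurable M" for k
    by (rule measurable_from_subalg[OF sub d_meas])
  have d_int: "integrable M (d k)" for k
    by (rule square_integrable_imp_integrable[OF d_measM d_sq])
  define B where "B k \<omega> = (if \<bar>t k \<omega>\<bar> < \<epsilon> then t k \<omega> else 0)" for k \<omega>
  have B_meas: "B k \<in> borel_measurable (F k)" for k
    unfolding B_def using t_meas[of k] by measurable
  have [measurable]: "B k \<in> borel_measurable M" for k
    by (rule measurable_from_subalg[OF sub B_meas])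
  have B_bd: "\<bar>B k \<omega>\<bar> \<le> \<epsilon>" for k \<omega> using \<epsilon> by (auto simp: B_def)
  have Bd_int: "integrable M (\<lambda>\<omega>. B k \<omega> * d k \<omega>)" for k
  proof (rule Bochner_Integration.integrable_bound)
    show "integrable M (\<lambda>\<omega>. \<epsilon> * d k \<omega>)" by (intro integrable_mult_right d_int)
    show "AE \<omega> in M. norm (B k \<omega> * d k \<omega>) \<le> norm (\<epsilon> * d k \<omega>)"
      using B_bd \<epsilon> by (auto simp: abs_mult intro!: mult_right_mono)
  qed measurable
  have t_step: "(t (Suc k) \<omega>)\<^sup>2 \<le> (t k \<omega>)\<^sup>2 + 2 * (B k \<omega> * d k \<omega>) + (d k \<omega>)\<^sup>2" for k \<omega>
    by (simp add: tS B_def power2_sum)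
  have t_sq: "integrable M (\<lambda>\<omega>. (t k \<omega>)\<^sup>2) \<and>
      (\<integral>\<omega>. (t k \<omega>)\<^sup>2 \<partial>M) \<le> (\<Sum>j<k. \<integral>\<omega>. (d j \<omega>)\<^sup>2 \<partial>M)" for k
  proof (induction k)
    case (Suc k)
    have int: "integrable M (\<lambda>\<omega>. (t k \<omega>)\<^sup>2 + 2 * (B k \<omega> * d k \<omega>) + (d k \<omega>)\<^sup>2)"
      using Suc by (intro Bochner_Integration.integrable_add integrable_mult_right Bd_int d_sq) auto
    have int': "integrable M (\<lambda>\<omega>. (t (Suc k) \<omega>)\<^sup>2)"
      by (rule Bochner_Integration.integrable_bound[OF int])
         (auto intro!: AE_I2 order_trans[OF t_step abs_ge_self])
    have "(\<integral>\<omega>. (t (Suc k) \<omega>)\<^sup>2 \<partial>M) \<le> (\<integral>\<omega>. (t k \<omega>)\<^sup>2 + 2 * (B k \<omega> * d k \<omega>) + (d k \<omega>)\<^sup>2 \<partial>M)"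
      by (intro integral_mono int int' t_step)
    also have "\<dots> = (\<integral>\<omega>. (t k \<omega>)\<^sup>2 \<partial>M) + (\<integral>\<omega>. (d k \<omega>)\<^sup>2 \<partial>M)"
      using Suc Bd_int[of k] d_sq[of k] orth[OF B_meas B_bd, of k] by simp
    finally show ?case using Suc int' by simp
  qed (simp add: t0)
  have hit: "if \<exists>j\<le>n. \<epsilon> \<le> \<bar>\<Sum>k<j. d k \<omega>\<bar> then \<epsilon> \<le> \<bar>t n \<omega>\<bar> else t n \<omega> = (\<Sum>k<n. d k \<omega>)" for n \<omega>
  proof (induction n)
    case (Suc n)
    then show ?case by (auto simp: tS le_Suc_eq split: if_splits)
  qed (use \<epsilon> in \<open>simp add: t0\<close>)
  have "measure M {\<omega>\<in>space M. \<exists>j\<le>n. \<epsilon> \<le> \<bar>\<Sum>k<j. d k \<omega>\<bar>} \<le> measure M {\<omega>\<in>space M. \<epsilon>\<^sup>2 \<le> (t n \<omega>)\<^sup>2}"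
  proof (rule finite_measure_mono)
    show "{\<omega>\<in>space M. \<exists>j\<le>n. \<epsilon> \<le> \<bar>\<Sum>k<j. d k \<omega>\<bar>} \<subseteq> {\<omega>\<in>space M. \<epsilon>\<^sup>2 \<le> (t n \<omega>)\<^sup>2}"
    proof safe
      fix \<omega> j assume "j \<le> n" "\<epsilon> \<le> \<bar>\<Sum>k<j. d k \<omega>\<bar>"
      then have "\<epsilon> \<le> \<bar>t n \<omega>\<bar>" using hit[of n \<omega>] by (auto split: if_splits)
      then have "\<epsilon>\<^sup>2 \<le> \<bar>t n \<omega>\<bar>\<^sup>2" using \<epsilon> by (intro power_mono) auto
      then show "\<epsilon>\<^sup>2 \<le> (t n \<omega>)\<^sup>2" by simp
    qed
  qed measurable
  also have "\<dots> \<le> (\<integral>\<omega>. (t n \<omega>)\<^sup>2 \<partial>M) / \<epsilon>\<^sup>2"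
    using t_sq[of n] \<epsilon> by (intro integral_Markov_inequality_measure[where A = "{}"]) auto
  also have "\<dots> \<le> (\<Sum>k<n. \<integral>\<omega>. (d k \<omega>)\<^sup>2 \<partial>M) / \<epsilon>\<^sup>2"
    using t_sq[of n] by (intro divide_right_mono) auto
  finally show ?thesis .
qed

text \<open>Applying the maximal inequality to the tails of the series bounds the probability that a tail has a
  large partial sum by a tail of the variance series, so almost surely the partial sums are Cauchy.\<close>

lemma L2_martingale_converges:
  fixes d :: "nat \<Rightarrow> 'w \<Rightarrow> real" and F :: "nat \<Rightarrow> 'w measure"
  assumes M: "prob_space M"
    and sub: "\<And>k. subalgebra M (F k)" and mono: "\<And>k. sets (F k) \<subseteq> sets (F (Suc k))"
    and d_meas: "\<And>k. d k \<in> borel_measurable (F (Suc k))"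
    and d_sq: "\<And>k. integrable M (\<lambda>\<omega>. (d k \<omega>)\<^sup>2)"
    and orth: "\<And>k B c. B \<in> borel_measurable (F k) \<Longrightarrow> (\<And>\<omega>. \<bar>B \<omega>\<bar> \<le> c) \<Longrightarrow>
      (\<integral>\<omega>. B \<omega> * d k \<omega> \<partial>M) = 0"
    and var: "summable (\<lambda>k. \<integral>\<omega>. (d k \<omega>)\<^sup>2 \<partial>M)"
  shows "AE \<omega> in M. summable (\<lambda>k. d k \<omega>)"
proof -
  interpret prob_space M by (rule M)
  have d_measM[measurable]: "d k \<in> borel_measurable M" for k
    by (rule measurable_from_subalg[OF sub d_meas])
  define v where "v k = (\<integral>\<omega>. (d k \<omega>)\<^sup>2 \<partial>M)" for k
  have v0: "0 \<le> v k" for k by (simp add: v_def)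
  have v_sum: "summable v" using var unfolding v_def .
  have small: "AE \<omega> in M. \<exists>N. \<forall>j. \<bar>\<Sum>k<j. d (k + N) \<omega>\<bar> < \<epsilon>" if \<epsilon>: "0 < \<epsilon>" for \<epsilon>
  proof -
    define bad where "bad N = {\<omega>\<in>space M. \<exists>j. \<epsilon> \<le> \<bar>\<Sum>k<j. d (k + N) \<omega>\<bar>}" for N
    have bad_meas[measurable]: "bad N \<in> sets M" for N unfolding bad_def by measurable
    have bad_le: "measure M (bad N) \<le> (\<Sum>k. v (k + N)) / \<epsilon>\<^sup>2" for N
    proof -
      define D where "D n = {\<omega>\<in>space M. \<exists>j\<le>n. \<epsilon> \<le> \<bar>\<Sum>k<j. d (k + N) \<omega>\<bar>}" for n
      have D_meas: "D n \<in> sets M" for n unfolding D_def by measurable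
      have D_le: "measure M (D n) \<le> (\<Sum>k. v (k + N)) / \<epsilon>\<^sup>2" for n
      proof -
        have "measure M (D n) \<le> (\<Sum>k<n. v (k + N)) / \<epsilon>\<^sup>2"
          unfolding D_def v_def
          by (rule L2_martingale_maximal_inequality[where F = "\<lambda>k. F (k + N)", OF M])
             (use sub mono d_meas d_sq \<epsilon> in \<open>auto intro: orth[of _ "_ + N"]\<close>)
        also have "\<dots> \<le> (\<Sum>k. v (k + N)) / \<epsilon>\<^sup>2"
          by (intro divide_right_mono sum_le_suminf summable_ignore_initial_segment v_sum) (auto simp: v0)
        finally show ?thesis .
      qed
      have "incseq D" by (auto simp: incseq_def D_def intro: order_trans)
      then have "(\<lambda>n. measure M (D n)) \<longlonglongrightarrow> measure M (\<Union>n. D n)"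
        using D_meas by (intro finite_Lim_measure_incseq) auto
      moreover have "(\<Union>n. D n) = bad N" by (auto simp: D_def bad_def)
      ultimately show ?thesis using D_le by (auto intro: LIMSEQ_le_const2)
    qed
    have "measure M (\<Inter>N. bad N) \<le> r" if r: "0 < r" for r
    proof -
      have "0 < r * \<epsilon>\<^sup>2" using r \<epsilon> by simp
      then obtain N where "norm (\<Sum>k. v (k + N)) < r * \<epsilon>\<^sup>2"
        using suminf_exist_split[OF _ v_sum] by blast
      then have "(\<Sum>k. v (k + N)) / \<epsilon>\<^sup>2 \<le> r" using \<epsilon> by (simp add: field_simps)
      moreover have "measure M (\<Inter>N. bad N) \<le> measure M (bad N)"
        by (rule finite_measure_mono) auto
      ultimately show ?thesis using bad_le[of N] by linarith
    qed
    then have "measure M (\<Inter>N. bad N) \<le> 0" by (rule field_le_epsilon) simp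
    then have "(\<Inter>N. bad N) \<in> null_sets M"
      by (simp add: null_sets_def emeasure_eq_measure measure_le_0_iff)
    then show ?thesis
      by (rule AE_I') (auto simp: bad_def not_less)
  qed
  have "AE \<omega> in M. \<forall>p::nat. \<exists>N. \<forall>j. \<bar>\<Sum>k<j. d (k + N) \<omega>\<bar> < 1 / Suc p"
    unfolding AE_all_countable by (intro allI small) simp
  then show ?thesis
  proof eventually_elim
    case (elim \<omega>)
    show ?case
      unfolding summable_Cauchy
    proof (intro allI impI)
      fix r :: real assume "0 < r"
      then obtain p where p: "inverse (real (Suc p)) < r / 2" using reals_Archimedean[of "r/2"] by auto
      obtain N where N: "\<And>j. \<bar>\<Sum>k<j. d (k + N) \<omega>\<bar> < 1 / Suc p" using elim by blast
      have shift: "(\<Sum>k<j. d (k + N) \<omega>) = sum (\<lambda>k. d k \<omega>) {N..<N + j}" for j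
        using sum.shift_bounds_nat_ivl[of "\<lambda>k. d k \<omega>" 0 N j] by (simp add: lessThan_atLeast0 add.commute)
      show "\<exists>N. \<forall>m\<ge>N. \<forall>n. norm (\<Sum>k = m..<n. d k \<omega>) < r"
      proof (intro exI[of _ N] allI impI)
        fix m n assume m: "N \<le> m"
        show "norm (\<Sum>k = m..<n. d k \<omega>) < r"
        proof (cases "m \<le> n")
          case True
          have "(\<Sum>k = N..<n. d k \<omega>) = (\<Sum>k = N..<m. d k \<omega>) + (\<Sum>k = m..<n. d k \<omega>)"
            using m True by (simp add: sum.atLeastLessThan_concat)
          moreover have "\<bar>\<Sum>k = N..<n. d k \<omega>\<bar> < r / 2" "\<bar>\<Sum>k = N..<m. d k \<omega>\<bar> < r / 2"
            using N[of "n - N"] N[of "m - N"] m True p by (auto simp: shift inverse_eq_divide)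
          ultimately show ?thesis unfolding real_norm_def by linarith
        qed (use \<open>0 < r\<close> in simp)
      qed
    qed
  qed
qed

lemma AE_summable_of_summable_integrals:
  fixes g :: "nat \<Rightarrow> 'w \<Rightarrow> real"
  assumes g: "\<And>k. integrable M (g k)" and nonneg: "\<And>k. AE \<omega> in M. 0 \<le> g k \<omega>"
    and sum: "summable (\<lambda>k. \<integral>\<omega>. g k \<omega> \<partial>M)"
  shows "AE \<omega> in M. summable (\<lambda>k. g k \<omega>)"
proof -
  have [measurable]: "g k \<in> borel_measurable M" for k using g[of k] by simp
  have int0: "0 \<le> (\<integral>\<omega>. g k \<omega> \<partial>M)" for k by (rule integral_nonneg_AE[OF nonneg])
  have "(\<integral>\<^sup>+\<omega>. (\<Sum>k. ennreal (g k \<omega>)) \<partial>M) = (\<Sum>k. \<integral>\<^sup>+\<omega>. ennreal (g k \<omega>) \<partial>M)"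
    by (rule nn_integral_suminf) measurable
  also have "\<dots> = (\<Sum>k. ennreal (\<integral>\<omega>. g k \<omega> \<partial>M))"
    by (simp add: nn_integral_eq_integral g nonneg)
  also have "\<dots> < \<infinity>"
    using suminf_ennreal2[OF int0 sum] by simp
  finally have "AE \<omega> in M. (\<Sum>k. ennreal (g k \<omega>)) \<noteq> \<infinity>"
    by (intro nn_integral_noteq_infinite) auto
  moreover have "AE \<omega> in M. \<forall>k. 0 \<le> g k \<omega>"
    unfolding AE_all_countable by (intro allI nonneg)
  ultimately show ?thesis
  proof eventually_elim
    case (elim \<omega>)
    then show ?case by (intro summable_suminf_not_top) auto
  qed
qed

lemma borel_measurable_vec_component:
  fixes f :: "'a \<Rightarrow> real^'n"
  assumes "f \<in> borel_measurable M"
  shows "(\<lambda>\<omega>. f \<omega> $ j) \<in> borel_measurable M"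
  using borel_measurable_inner[OF assms borel_measurable_const[of "axis j 1"]]
  by (simp add: inner_axis)

lemma borel_measurable_vec_cond_exp_inner:
  assumes "Y \<in> borel_measurable F"
  shows "(\<lambda>\<omega>. vec_cond_exp M F e \<omega> \<bullet> Y \<omega>) \<in> borel_measurable F"
  using borel_measurable_vec_component[OF assms]
  by (simp add: inner_vec_def vec_cond_exp_def)

text \<open>A factor known at the time of conditioning may be moved in and out of a conditional expectation. The
  second moment bound makes all products integrable: it gives
  \<open>E (\<parallel>Y\<parallel>\<^sup>2 \<parallel>e\<parallel>\<^sup>2) = E (\<parallel>Y\<parallel>\<^sup>2 E[\<parallel>e\<parallel>\<^sup>2 | F]) \<le> \<nu>\<^sup>2 E \<parallel>Y\<parallel>\<^sup>2\<close>.\<close>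

lemma (in finite_measure_subalgebra) noise_inner_conditioned:
  fixes e Y :: "'a \<Rightarrow> real^'n"
  assumes e[measurable]: "e \<in> borel_measurable M" and Y: "Y \<in> borel_measurable F"
    and moment: "AE \<omega> in M. nn_cond_exp M F (\<lambda>\<omega>'. ennreal ((norm (e \<omega>'))\<^sup>2)) \<omega> \<le> ennreal (\<nu>\<^sup>2)"
    and Y_sq: "integrable M (\<lambda>\<omega>. (norm (Y \<omega>))\<^sup>2)"
  shows "integrable M (\<lambda>\<omega>. (norm (Y \<omega>))\<^sup>2 * (norm (e \<omega>))\<^sup>2)" (is "integrable M ?P")
    and "(\<integral>\<omega>. (norm (Y \<omega>))\<^sup>2 * (norm (e \<omega>))\<^sup>2 \<partial>M) \<le> \<nu>\<^sup>2 * (\<integral>\<omega>. (norm (Y \<omega>))\<^sup>2 \<partial>M)"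
    and "integrable M (\<lambda>\<omega>. e \<omega> \<bullet> Y \<omega>)"
    and "integrable M (\<lambda>\<omega>. vec_cond_exp M F e \<omega> \<bullet> Y \<omega>)"
    and "(\<integral>\<omega>. e \<omega> \<bullet> Y \<omega> \<partial>M) = (\<integral>\<omega>. vec_cond_exp M F e \<omega> \<bullet> Y \<omega> \<partial>M)"
proof -
  note YF[measurable] = Y
  have YM[measurable]: "Y \<in> borel_measurable M" by (rule measurable_from_subalg[OF subalg Y])
  let ?I = "\<integral>\<omega>. (norm (Y \<omega>))\<^sup>2 \<partial>M"
  have "(\<integral>\<^sup>+\<omega>. ennreal (?P \<omega>) \<partial>M) = (\<integral>\<^sup>+\<omega>. ennreal ((norm (Y \<omega>))\<^sup>2) * ennreal ((norm (e \<omega>))\<^sup>2) \<partial>M)"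
    by (simp add: ennreal_mult)
  also have "\<dots> = (\<integral>\<^sup>+\<omega>. ennreal ((norm (Y \<omega>))\<^sup>2) * nn_cond_exp M F (\<lambda>\<omega>'. ennreal ((norm (e \<omega>'))\<^sup>2)) \<omega> \<partial>M)"
    by (rule nn_cond_exp_intg[symmetric]) measurable
  also have "\<dots> \<le> (\<integral>\<^sup>+\<omega>. ennreal ((norm (Y \<omega>))\<^sup>2) * ennreal (\<nu>\<^sup>2) \<partial>M)"
    by (rule nn_integral_mono_AE) (rule eventually_mono[OF moment], rule mult_left_mono, auto)
  also have "\<dots> = ennreal ?I * ennreal (\<nu>\<^sup>2)"
    by (simp add: nn_integral_multc nn_integral_eq_integral[OF Y_sq])
  also have "\<dots> = ennreal (\<nu>\<^sup>2 * ?I)"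
    by (simp add: ennreal_mult' mult.commute)
  finally have le: "(\<integral>\<^sup>+\<omega>. ennreal (?P \<omega>) \<partial>M) \<le> ennreal (\<nu>\<^sup>2 * ?I)" .
  show P: "integrable M ?P"
    using le by (intro integrableI_bounded) (auto simp: order_le_less_trans[OF _ ennreal_less_top])
  show "(\<integral>\<omega>. ?P \<omega> \<partial>M) \<le> \<nu>\<^sup>2 * ?I"
  proof -
    have "ennreal (\<integral>\<omega>. ?P \<omega> \<partial>M) \<le> ennreal (\<nu>\<^sup>2 * ?I)"
      using le nn_integral_eq_integral[OF P] by simp
    then show ?thesis by (simp add: ennreal_le_iff)
  qed
  have "integrable M (\<lambda>\<omega>. norm (Y \<omega>) * norm (e \<omega>))"
    by (rule square_integrable_imp_integrable) (use P in \<open>simp_all add: power_mult_distrib\<close>)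
  then have comp: "integrable M (\<lambda>\<omega>. Y \<omega> $ j * e \<omega> $ j)" for j
  proof (rule Bochner_Integration.integrable_bound)
    show "(\<lambda>\<omega>. Y \<omega> $ j * e \<omega> $ j) \<in> borel_measurable M"
      by (intro borel_measurable_times borel_measurable_vec_component YM e)
    show "AE \<omega> in M. norm (Y \<omega> $ j * e \<omega> $ j) \<le> norm (norm (Y \<omega>) * norm (e \<omega>))"
      by (auto simp: abs_mult intro!: mult_mono component_le_norm_cart)
  qed
  note cond = real_cond_exp_intg[OF comp borel_measurable_vec_component[OF Y] borel_measurable_vec_component[OF e]]
  have ex: "(\<lambda>\<omega>. e \<omega> \<bullet> Y \<omega>) = (\<lambda>\<omega>. \<Sum>j\<in>UNIV. Y \<omega> $ j * e \<omega> $ j)"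
    "(\<lambda>\<omega>. vec_cond_exp M F e \<omega> \<bullet> Y \<omega>)
      = (\<lambda>\<omega>. \<Sum>j\<in>UNIV. Y \<omega> $ j * real_cond_exp M F (\<lambda>\<omega>'. e \<omega>' $ j) \<omega>)"
    by (simp_all add: inner_vec_def vec_cond_exp_def mult.commute)
  show "integrable M (\<lambda>\<omega>. e \<omega> \<bullet> Y \<omega>)"
    unfolding ex by (intro Bochner_Integration.integrable_sum comp)
  show "integrable M (\<lambda>\<omega>. vec_cond_exp M F e \<omega> \<bullet> Y \<omega>)"
    unfolding ex by (intro Bochner_Integration.integrable_sum cond)
  show "(\<integral>\<omega>. e \<omega> \<bullet> Y \<omega> \<partial>M) = (\<integral>\<omega>. vec_cond_exp M F e \<omega> \<bullet> Y \<omega> \<partial>M)"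
    unfolding ex by (simp add: Bochner_Integration.integral_sum comp cond)
qed

text \<open>The bias contributes at most \<open>b E \<parallel>Y\<parallel>\<close>; it is written as a multiple of \<open>1 + E \<parallel>Y\<parallel>\<^sup>2\<close>, a form that a
  recursion for second moments can absorb.\<close>

lemma (in finite_measure_subalgebra) noise_inner_expectation_ge:
  fixes e Y :: "'a \<Rightarrow> real^'n"
  assumes prob: "prob_space M"
    and e: "e \<in> borel_measurable M" and Y: "Y \<in> borel_measurable F"
    and mean: "AE \<omega> in M. norm (vec_cond_exp M F e \<omega>) \<le> b" and b: "0 \<le> b"
    and moment: "AE \<omega> in M. nn_cond_exp M F (\<lambda>\<omega>'. ennreal ((norm (e \<omega>'))\<^sup>2)) \<omega> \<le> ennreal (\<nu>\<^sup>2)"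
    and Y_sq: "integrable M (\<lambda>\<omega>. (norm (Y \<omega>))\<^sup>2)"
  shows "- (\<integral>\<omega>. e \<omega> \<bullet> Y \<omega> \<partial>M) \<le> b * (1 + (\<integral>\<omega>. (norm (Y \<omega>))\<^sup>2 \<partial>M))"
proof -
  note n = noise_inner_conditioned[OF e Y moment Y_sq]
  have "(\<integral>\<omega>. - (vec_cond_exp M F e \<omega> \<bullet> Y \<omega>) \<partial>M) \<le> (\<integral>\<omega>. b * (1 + (norm (Y \<omega>))\<^sup>2) \<partial>M)"
  proof (rule integral_mono_AE)
    show "AE \<omega> in M. - (vec_cond_exp M F e \<omega> \<bullet> Y \<omega>) \<le> b * (1 + (norm (Y \<omega>))\<^sup>2)"
      using mean
    proof eventually_elim
      case (elim \<omega>)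
      let ?v = "vec_cond_exp M F e \<omega>"
      have "- (?v \<bullet> Y \<omega>) \<le> norm ?v * norm (Y \<omega>)"
        using Cauchy_Schwarz_ineq2[of ?v "Y \<omega>"] by linarith
      also have "\<dots> \<le> b * (1 + (norm (Y \<omega>))\<^sup>2)"
        by (intro mult_mono elim b le_one_plus_square) simp
      finally show ?case .
    qed
  qed (auto intro!: n Y_sq)
  also have "\<dots> = b * (1 + (\<integral>\<omega>. (norm (Y \<omega>))\<^sup>2 \<partial>M))"
    using Y_sq by (simp add: prob_space.prob_space[OF prob])
  finally show ?thesis using n(5) by simp
qed

text \<open>The inner product with the error splits into its conditional mean, of size at most \<open>\<mu> \<parallel>Y\<parallel>\<close>, and a
  martingale increment. With \<open>E \<parallel>Y k\<parallel>\<^sup>2\<close> bounded, the first contributes a series with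
  summable first moments and the second one with summable second moments.\<close>

lemma weighted_noise_series_converges:
  fixes e Y :: "nat \<Rightarrow> 'w \<Rightarrow> real^'n" and F :: "nat \<Rightarrow> 'w measure" and b \<mu> \<nu> :: "nat \<Rightarrow> real"
  assumes M: "prob_space M"
    and sub: "\<And>k. subalgebra M (F k)" and mono: "\<And>k. sets (F k) \<subseteq> sets (F (Suc k))"
    and e: "\<And>k. e k \<in> borel_measurable (F (Suc k))" and Y: "\<And>k. Y k \<in> borel_measurable (F k)"
    and mean: "\<And>k. AE \<omega> in M. norm (vec_cond_exp M (F k) (e k) \<omega>) \<le> \<mu> k"
    and moment: "\<And>k. AE \<omega> in M.
      nn_cond_exp M (F k) (\<lambda>\<omega>'. ennreal ((norm (e k \<omega>'))\<^sup>2)) \<omega> \<le> ennreal ((\<nu> k)\<^sup>2)"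
    and b: "\<And>k. 0 \<le> b k" and \<mu>: "\<And>k. 0 \<le> \<mu> k"
    and b\<mu>: "summable (\<lambda>k. b k * \<mu> k)" and b\<nu>: "summable (\<lambda>k. (b k)\<^sup>2 * (\<nu> k)\<^sup>2)"
    and Y_sq: "\<And>k. integrable M (\<lambda>\<omega>. (norm (Y k \<omega>))\<^sup>2)"
    and Y_bd: "\<And>k. (\<integral>\<omega>. (norm (Y k \<omega>))\<^sup>2 \<partial>M) \<le> D"
  shows "AE \<omega> in M. summable (\<lambda>k. b k * (e k \<omega> \<bullet> Y k \<omega>))"
proof -
  interpret prob_space M by (rule M)
  have fin: "finite_measure_subalgebra M (F k)" for k
    by (intro finite_measure_subalgebra.intro finite_measure_subalgebra_axioms.intro
        finite_measure_axioms sub)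
  have eM[measurable]: "e k \<in> borel_measurable M" for k by (rule measurable_from_subalg[OF sub e])
  have YM[measurable]: "Y k \<in> borel_measurable M" for k by (rule measurable_from_subalg[OF sub Y])
  have up: "g \<in> borel_measurable (F (Suc k))" if "g \<in> borel_measurable (F k)" for g :: "'w \<Rightarrow> 'z::{second_countable_topology,real_normed_vector}" and k
    using that sub mono by (intro measurable_from_subalg[of "F (Suc k)" "F k"]) (auto simp: subalgebra_def)
  define v where "v k \<omega> = vec_cond_exp M (F k) (e k) \<omega> \<bullet> Y k \<omega>" for k \<omega>
  have v_meas: "v k \<in> borel_measurable (F k)" for k
    unfolding v_def by (rule borel_measurable_vec_cond_exp_inner[OF Y])
  have [measurable]: "v k \<in> borel_measurable M" for k by (rule measurable_from_subalg[OF sub v_meas])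
  have v_bd: "AE \<omega> in M. \<bar>v k \<omega>\<bar> \<le> \<mu> k * norm (Y k \<omega>)" for k
    using mean[of k]
  proof eventually_elim
    case (elim \<omega>)
    have "\<bar>v k \<omega>\<bar> \<le> norm (vec_cond_exp M (F k) (e k) \<omega>) * norm (Y k \<omega>)"
      unfolding v_def by (rule Cauchy_Schwarz_ineq2)
    also have "\<dots> \<le> \<mu> k * norm (Y k \<omega>)" by (intro mult_right_mono elim) simp
    finally show ?case .
  qed
  note cond = finite_measure_subalgebra.noise_inner_conditioned[OF fin eM _ moment]
  have D: "0 \<le> D" using order_trans[OF _ Y_bd[of 0]] by simp
  have Y_int: "integrable M (\<lambda>\<omega>. norm (Y k \<omega>))" for k
    by (rule square_integrable_imp_integrable[OF _ Y_sq]) measurable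
  \<comment> \<open>The centred summands, whose second moments are summable.\<close>
  define d where "d k \<omega> = b k * (e k \<omega> \<bullet> Y k \<omega> - v k \<omega>)" for k \<omega>
  have [measurable]: "d k \<in> borel_measurable M" for k unfolding d_def by measurable
  have d_bd: "AE \<omega> in M. (d k \<omega>)\<^sup>2 \<le> 2 * (b k)\<^sup>2 * ((norm (Y k \<omega>))\<^sup>2 * (norm (e k \<omega>))\<^sup>2)
      + 2 * (b k * \<mu> k)\<^sup>2 * (norm (Y k \<omega>))\<^sup>2" for k
    using v_bd[of k]
  proof eventually_elim
    case (elim \<omega>)
    have "(e k \<omega> \<bullet> Y k \<omega>)\<^sup>2 \<le> (norm (Y k \<omega>))\<^sup>2 * (norm (e k \<omega>))\<^sup>2"
      using Cauchy_Schwarz_ineq[of "e k \<omega>" "Y k \<omega>"] by (simp add: power2_norm_eq_inner mult.commute)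
    moreover have "(v k \<omega>)\<^sup>2 \<le> (\<mu> k * norm (Y k \<omega>))\<^sup>2"
      using power_mono[OF elim, of 2] by simp
    moreover have "(e k \<omega> \<bullet> Y k \<omega> - v k \<omega>)\<^sup>2 \<le> 2 * (e k \<omega> \<bullet> Y k \<omega>)\<^sup>2 + 2 * (v k \<omega>)\<^sup>2"
      using zero_le_power2[of "e k \<omega> \<bullet> Y k \<omega> + v k \<omega>"] unfolding power2_sum power2_diff by linarith
    ultimately have "(e k \<omega> \<bullet> Y k \<omega> - v k \<omega>)\<^sup>2
        \<le> 2 * ((norm (Y k \<omega>))\<^sup>2 * (norm (e k \<omega>))\<^sup>2) + 2 * (\<mu> k * norm (Y k \<omega>))\<^sup>2"
      by linarith
    then have "(b k)\<^sup>2 * (e k \<omega> \<bullet> Y k \<omega> - v k \<omega>)\<^sup>2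
        \<le> (b k)\<^sup>2 * (2 * ((norm (Y k \<omega>))\<^sup>2 * (norm (e k \<omega>))\<^sup>2) + 2 * (\<mu> k * norm (Y k \<omega>))\<^sup>2)"
      by (intro mult_left_mono) auto
    then show ?case unfolding d_def power_mult_distrib by (simp add: algebra_simps)
  qed
  have dom_int: "integrable M (\<lambda>\<omega>. 2 * (b k)\<^sup>2 * ((norm (Y k \<omega>))\<^sup>2 * (norm (e k \<omega>))\<^sup>2)
      + 2 * (b k * \<mu> k)\<^sup>2 * (norm (Y k \<omega>))\<^sup>2)" for k
    by (intro Bochner_Integration.integrable_add integrable_mult_right cond(1) Y Y_sq)
  have d_sq: "integrable M (\<lambda>\<omega>. (d k \<omega>)\<^sup>2)" for k
    by (rule Bochner_Integration.integrable_bound[OF dom_int[of k]]) (use d_bd[of k] in auto)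
  have d_var: "summable (\<lambda>k. \<integral>\<omega>. (d k \<omega>)\<^sup>2 \<partial>M)"
  proof (rule summable_comparison_test')
    have "summable (\<lambda>k. (b k * \<mu> k)\<^sup>2)"
    proof (rule summable_comparison_test_ev[OF _ b\<mu>])
      have "eventually (\<lambda>k. b k * \<mu> k < 1) sequentially"
        using summable_LIMSEQ_zero[OF b\<mu>] by (rule order_tendstoD) simp
      then show "eventually (\<lambda>k. norm ((b k * \<mu> k)\<^sup>2) \<le> b k * \<mu> k) sequentially"
      proof eventually_elim
        case (elim k)
        then show ?case using mult_left_mono[of "b k * \<mu> k" 1 "b k * \<mu> k"] b[of k] \<mu>[of k]
          by (simp add: power2_eq_square)
      qed
    qed
    then show "summable (\<lambda>k. 2 * D * ((b k)\<^sup>2 * (\<nu> k)\<^sup>2) + 2 * D * (b k * \<mu> k)\<^sup>2)"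
      by (intro summable_add summable_mult b\<nu>)
    fix k :: nat assume "0 \<le> k"
    have "(\<integral>\<omega>. (d k \<omega>)\<^sup>2 \<partial>M) \<le> (\<integral>\<omega>. 2 * (b k)\<^sup>2 * ((norm (Y k \<omega>))\<^sup>2 * (norm (e k \<omega>))\<^sup>2)
      + 2 * (b k * \<mu> k)\<^sup>2 * (norm (Y k \<omega>))\<^sup>2 \<partial>M)"
      by (intro integral_mono_AE d_sq dom_int d_bd)
    also have "\<dots> = 2 * (b k)\<^sup>2 * (\<integral>\<omega>. (norm (Y k \<omega>))\<^sup>2 * (norm (e k \<omega>))\<^sup>2 \<partial>M)
      + 2 * (b k * \<mu> k)\<^sup>2 * (\<integral>\<omega>. (norm (Y k \<omega>))\<^sup>2 \<partial>M)"
      by (subst Bochner_Integration.integral_add)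
         (auto intro!: integrable_mult_right cond(1) Y Y_sq)
    also have "\<dots> \<le> 2 * (b k)\<^sup>2 * ((\<nu> k)\<^sup>2 * D) + 2 * (b k * \<mu> k)\<^sup>2 * D"
      using cond(2)[OF Y Y_sq, of k] mult_left_mono[OF Y_bd[of k], of "(\<nu> k)\<^sup>2"]
      by (intro add_mono mult_left_mono Y_bd) auto
    finally show "norm (\<integral>\<omega>. (d k \<omega>)\<^sup>2 \<partial>M)
        \<le> 2 * D * ((b k)\<^sup>2 * (\<nu> k)\<^sup>2) + 2 * D * (b k * \<mu> k)\<^sup>2"
      by (simp add: algebra_simps)
  qed
  have d_F: "d k \<in> borel_measurable (F (Suc k))" for k
    unfolding d_def using e[of k] up[OF Y[of k]] up[OF v_meas[of k]] by measurable
  have d_orth: "(\<integral>\<omega>. B \<omega> * d k \<omega> \<partial>M) = 0"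
    if B: "B \<in> borel_measurable (F k)" and c: "\<And>\<omega>. \<bar>B \<omega>\<bar> \<le> c" for k B c
  proof -
    have BM[measurable]: "B \<in> borel_measurable M" by (rule measurable_from_subalg[OF sub B])
    \<comment> \<open>A bounded test function is absorbed into the known factor.\<close>
    have Z: "(\<lambda>\<omega>. B \<omega> *\<^sub>R Y k \<omega>) \<in> borel_measurable (F k)" using B Y[of k] by measurable
    have Z_sq: "integrable M (\<lambda>\<omega>. (norm (B \<omega> *\<^sub>R Y k \<omega>))\<^sup>2)"
    proof (rule Bochner_Integration.integrable_bound)
      show "integrable M (\<lambda>\<omega>. c\<^sup>2 * (norm (Y k \<omega>))\<^sup>2)" by (intro integrable_mult_right Y_sq)
      have "(norm (B \<omega> *\<^sub>R Y k \<omega>))\<^sup>2 \<le> c\<^sup>2 * (norm (Y k \<omega>))\<^sup>2" for \<omega>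
        using power_mono[OF c[of \<omega>], of 2] by (auto simp: power_mult_distrib intro!: mult_right_mono)
      then show "AE \<omega> in M. norm ((norm (B \<omega> *\<^sub>R Y k \<omega>))\<^sup>2) \<le> norm (c\<^sup>2 * (norm (Y k \<omega>))\<^sup>2)"
        by simp
    qed measurable
    have "(\<lambda>\<omega>. B \<omega> * d k \<omega>) = (\<lambda>\<omega>. b k * (e k \<omega> \<bullet> (B \<omega> *\<^sub>R Y k \<omega>)
        - vec_cond_exp M (F k) (e k) \<omega> \<bullet> (B \<omega> *\<^sub>R Y k \<omega>)))"
      by (simp add: d_def v_def algebra_simps)
    then show ?thesis
      using cond(3,4,5)[OF Z Z_sq] by simp
  qed
  have mart: "AE \<omega> in M. summable (\<lambda>k. d k \<omega>)"
    by (rule L2_martingale_converges[where d = d and F = F, OF M sub mono d_F d_sq d_orth d_var])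
  \<comment> \<open>The conditional means, which form an absolutely convergent series almost surely.\<close>
  have "AE \<omega> in M. summable (\<lambda>k. b k * \<mu> k * norm (Y k \<omega>))"
  proof (rule AE_summable_of_summable_integrals)
    show "integrable M (\<lambda>\<omega>. b k * \<mu> k * norm (Y k \<omega>))" for k by (intro integrable_mult_right Y_int)
    show "AE \<omega> in M. 0 \<le> b k * \<mu> k * norm (Y k \<omega>)" for k using b \<mu> by simp
    show "summable (\<lambda>k. \<integral>\<omega>. b k * \<mu> k * norm (Y k \<omega>) \<partial>M)"
    proof (rule summable_comparison_test')
      show "summable (\<lambda>k. b k * \<mu> k * (1 + D))" by (intro summable_mult2 b\<mu>)
      fix k :: nat assume "0 \<le> k"
      have "(\<integral>\<omega>. norm (Y k \<omega>) \<partial>M) \<le> (\<integral>\<omega>. 1 + (norm (Y k \<omega>))\<^sup>2 \<partial>M)"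
        by (intro integral_mono Y_int Bochner_Integration.integrable_add Y_sq le_one_plus_square) auto
      also have "\<dots> \<le> 1 + D" using Y_bd[of k] Y_sq[of k] by (simp add: prob_space)
      finally have "b k * \<mu> k * (\<integral>\<omega>. norm (Y k \<omega>) \<partial>M) \<le> b k * \<mu> k * (1 + D)"
        by (intro mult_left_mono) (auto simp: b \<mu>)
      then show "norm (\<integral>\<omega>. b k * \<mu> k * norm (Y k \<omega>) \<partial>M) \<le> b k * \<mu> k * (1 + D)"
        using b \<mu> by (simp add: abs_mult integral_nonneg)
    qed
  qed
  moreover have "AE \<omega> in M. \<forall>k. \<bar>v k \<omega>\<bar> \<le> \<mu> k * norm (Y k \<omega>)"
    unfolding AE_all_countable by (intro allI v_bd)
  ultimately have "AE \<omega> in M. summable (\<lambda>k. b k * v k \<omega>)"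
  proof eventually_elim
    case (elim \<omega>)
    show ?case
    proof (rule summable_comparison_test'[OF elim(1)])
      show "norm (b k * v k \<omega>) \<le> b k * \<mu> k * norm (Y k \<omega>)" if "0 \<le> k" for k
        using mult_left_mono[OF elim(2)[rule_format, of k] b[of k]] b[of k] by (simp add: abs_mult mult.assoc)
    qed
  qed
  with mart show ?thesis
  proof eventually_elim
    case (elim \<omega>)
    have "(\<lambda>k. b k * (e k \<omega> \<bullet> Y k \<omega>)) = (\<lambda>k. d k \<omega> + b k * v k \<omega>)"
      by (simp add: d_def algebra_simps)
    then show ?case using summable_add[OF elim] by simp
  qed
qed

section \<open>The history of the method\<close>

lemma sets_history_subset:
  assumes "k < k' \<and> i \<le> m \<or> k = k' \<and> i \<le> i'"
  shows "sets (history M m x0 err i k) \<subseteq> sets (history M m x0 err i' k')"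
proof -
  have "(l < k' \<and> j \<le> m \<or> l = k' \<and> j \<le> i')" if "l < k \<and> j \<le> m \<or> l = k \<and> j \<le> i" for l j :: nat
    using assms that by auto
  then show ?thesis
    unfolding history_def
    by (subst (1 2) sets_measure_of) (blast, blast, intro sigma_sets_mono' Un_mono subset_refl, blast)
qed

lemma space_history: "space (history M m x0 err i k) = space M"
  by (simp add: history_def space_measure_of_conv)

lemma measurable_history_initial: "x0 \<in> borel_measurable (history M m x0 err i k)"
proof (rule measurableI)
  fix A :: "(real^'b) set" assume "A \<in> sets borel"
  then show "x0 -` A \<inter> space (history M m x0 err i k) \<in> sets (history M m x0 err i k)"
    unfolding space_history unfolding history_def
    by (subst sets_measure_of) (auto intro!: sigma_sets.Basic)
qed simp

lemma measurable_history_error: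
  assumes "1 \<le> j" "1 \<le> l" "l < k \<and> j \<le> m \<or> l = k \<and> j \<le> i"
  shows "err j l \<in> borel_measurable (history M m x0 err i k)"
proof (rule measurableI)
  fix A :: "(real^'b) set" assume "A \<in> sets borel"
  then have "err j l -` A \<inter> space M \<in> {x0 -` A \<inter> space M | A. A \<in> sets borel} \<union>
      {err j l -` A \<inter> space M | j l A. A \<in> sets borel \<and> 1 \<le> j \<and> 1 \<le> l \<and>
         (l < k \<and> j \<le> m \<or> l = k \<and> j \<le> i)}"
    using assms by blast
  then show "err j l -` A \<inter> space (history M m x0 err i k) \<in> sets (history M m x0 err i k)"
    unfolding space_history unfolding history_def by (subst sets_measure_of) auto
qed simp

lemma subalgebra_history:
  assumes "x0 \<in> borel_measurable M"
    and "\<And>j l. 1 \<le> j \<Longrightarrow> j \<le> m \<Longrightarrow> 1 \<le> l \<Longrightarrow> err j l \<in> borel_measurable M"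
    and "i \<le> m"
  shows "subalgebra M (history M m x0 err i k)"
  unfolding subalgebra_def space_history
  using assms unfolding history_def
  by (subst sets_measure_of) (auto intro!: sets.sigma_sets_subset measurable_sets)

section \<open>Convergence of the method\<close>

theorem theorem3p3:
  fixes M :: "'w measure"
    and X :: "(real^'n) set"
    and m :: nat
    and f :: "nat \<Rightarrow> real^'n \<Rightarrow> real"
    and ftot :: "real^'n \<Rightarrow> real"
    and \<alpha> \<mu> \<nu> :: "nat \<Rightarrow> real"
    and x :: "nat \<Rightarrow> 'w \<Rightarrow> real^'n"
    and z err sg :: "nat \<Rightarrow> nat \<Rightarrow> 'w \<Rightarrow> real^'n"
  assumes prob: "prob_space M"
    and X: "X \<noteq> {}" "closed X" "convex X"
    and f_convex: "\<forall>i\<in>{1..m}. convex_on UNIV (f i)"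
    and ftot: "ftot = (\<lambda>y. \<Sum>i=1..m. f i y)"
    and opt_finite: "bdd_below (ftot ` X)"
    and opt_nonempty: "optimal_set X ftot \<noteq> {}"
    and subgrad_bound:
      "\<forall>i\<in>{1..m}. \<exists>C. \<forall>y\<in>X. \<forall>v. is_subgradient (f i) y v \<longrightarrow> norm v \<le> C"
    and x0_rv: "x 0 \<in> borel_measurable M"
    and x0_in: "\<forall>\<omega>\<in>space M. x 0 \<omega> \<in> X"
    and err_rv: "\<forall>i\<in>{1..m}. \<forall>k\<ge>1. err i k \<in> borel_measurable M"
    and sg: "\<forall>i\<in>{1..m}. \<forall>k\<ge>1. \<forall>\<omega>\<in>space M. is_subgradient (f i) (z (i - 1) k \<omega>) (sg i k \<omega>)"
    and z_start: "\<forall>k. \<forall>\<omega>\<in>space M. z 0 (k + 1) \<omega> = x k \<omega>"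
    and z_step: "\<forall>k. \<forall>i\<in>{1..m}. \<forall>\<omega>\<in>space M. z i (k + 1) \<omega> =
        closest_point X (z (i - 1) (k + 1) \<omega> - \<alpha> (k + 1) *\<^sub>R (sg i (k + 1) \<omega> + err i (k + 1) \<omega>))"
    and x_step: "\<forall>k. \<forall>\<omega>\<in>space M. x (k + 1) \<omega> = z m (k + 1) \<omega>"
    and z_adapted:
      "\<forall>i\<in>{1..m}. \<forall>k\<ge>1. z i k \<in> borel_measurable (history M m (x 0) err i k)"
    and \<mu>\<nu>_nonneg: "\<forall>k\<ge>1. 0 \<le> \<mu> k" "\<forall>k\<ge>1. 0 \<le> \<nu> k"
    and err_mean: "\<forall>i\<in>{1..m}. \<forall>k\<ge>1. AE \<omega> in M.
        norm (vec_cond_exp M (history M m (x 0) err (i - 1) k) (err i k) \<omega>) \<le> \<mu> k"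
    and err_second_moment: "\<forall>i\<in>{1..m}. \<forall>k\<ge>1. AE \<omega> in M.
        nn_cond_exp M (history M m (x 0) err (i - 1) k)
          (\<lambda>\<omega>'. ennreal ((norm (err i k \<omega>'))\<^sup>2)) \<omega> \<le> ennreal ((\<nu> k)\<^sup>2)"
    and \<alpha>_pos: "\<forall>k\<ge>1. 0 < \<alpha> k"
    and \<alpha>_sum: "filterlim (\<lambda>N. \<Sum>k=1..N. \<alpha> k) at_top sequentially"
    and \<alpha>_sq: "summable (\<lambda>k. (\<alpha> (Suc k))\<^sup>2)"
    and \<alpha>\<mu>: "summable (\<lambda>k. \<alpha> (Suc k) * \<mu> (Suc k))"
    and \<alpha>\<nu>: "summable (\<lambda>k. (\<alpha> (Suc k))\<^sup>2 * (\<nu> (Suc k))\<^sup>2)"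
  shows "AE \<omega> in M. \<exists>p\<in>optimal_set X ftot. (\<lambda>k. x k \<omega>) \<longlonglongrightarrow> p"
proof -
  interpret prob_space M by (rule prob)
  let ?H = "history M m (x 0) err"
  \<comment> \<open>Cycles are counted from \<open>0\<close> from here on.\<close>
  define a where "a k = \<alpha> (Suc k)" for k
  define b where "b k = \<mu> (Suc k)" for k
  define c where "c k = \<nu> (Suc k)" for k
  have a: "0 < a k" "0 \<le> a k" for k using \<alpha>_pos by (auto simp: a_def intro: less_imp_le)
  have b: "0 \<le> b k" for k using \<mu>\<nu>_nonneg by (simp add: b_def)
  have ab: "summable (\<lambda>k. a k * b k)" using \<alpha>\<mu> by (simp add: a_def b_def)
  have ac: "summable (\<lambda>k. (a k)\<^sup>2 * (c k)\<^sup>2)" using \<alpha>\<nu> by (simp add: a_def c_def)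
  have aa: "summable (\<lambda>k. (a k)\<^sup>2)" using \<alpha>_sq by (simp add: a_def)
  have a_inf: "\<not> summable a"
  proof
    assume s: "summable a"
    have "(\<Sum>k=1..N. \<alpha> k) = sum a {..<N}" for N
      by (rule sum.reindex_bij_witness[of _ Suc "\<lambda>k. k - 1"]) (auto simp: a_def)
    then have "filterlim (\<lambda>N. sum a {..<N}) at_top sequentially" using \<alpha>_sum by simp
    with summable_LIMSEQ[OF s] show False
      using not_tendsto_and_filterlim_at_infinity[OF sequentially_bot] filterlim_at_top_imp_at_infinity by blast
  qed
  define e where "e i k = err i (Suc k)" for i k
  \<comment> \<open>For fixed \<open>i\<close>, the information available just before the \<open>i\<close>-th error of each cycle is a filtration
      in the cycle index \<open>k\<close>; so each \<open>i\<close> gives its own martingale, indexed by cycles.\<close>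
  define G where "G i k = ?H (i - 1) (Suc k)" for i k
  have eM: "e i k \<in> borel_measurable M" if "i \<in> {1..m}" for i k
    using err_rv that by (simp add: e_def)
  have G_sub: "subalgebra M (G i k)" if "i \<in> {1..m}" for i k
    unfolding G_def using that err_rv x0_rv by (intro subalgebra_history) auto
  have G_mono: "sets (G i k) \<subseteq> sets (G i (Suc k))" if "i \<in> {1..m}" for i k
    unfolding G_def using that by (intro sets_history_subset) auto
  have e_G: "e i k \<in> borel_measurable (G i (Suc k))" if "i \<in> {1..m}" for i k
    unfolding G_def e_def using that by (intro measurable_history_error) auto
  have fin: "finite_measure_subalgebra M (G i k)" if "i \<in> {1..m}" for i k
    by (intro finite_measure_subalgebra.intro finite_measure_subalgebra_axioms.intro
        finite_measure_axioms G_sub that)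
  have mean: "AE \<omega> in M. norm (vec_cond_exp M (G i k) (e i k) \<omega>) \<le> b k" if "i \<in> {1..m}" for i k
    using err_mean that by (simp add: G_def e_def b_def)
  have moment: "AE \<omega> in M. nn_cond_exp M (G i k)
      (\<lambda>\<omega>'. ennreal ((norm (e i k \<omega>'))\<^sup>2)) \<omega> \<le> ennreal ((c k)\<^sup>2)" if "i \<in> {1..m}" for i k
    using err_second_moment that by (simp add: G_def e_def c_def)
  have cond: "integrable M (\<lambda>\<omega>. e i k \<omega> \<bullet> Y \<omega>)"
      "- (\<integral>\<omega>. e i k \<omega> \<bullet> Y \<omega> \<partial>M) \<le> b k * (1 + (\<integral>\<omega>. (norm (Y \<omega>))\<^sup>2 \<partial>M))"
    if i: "i \<in> {1..m}" and Y: "Y \<in> borel_measurable (G i k)"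
      and Y_sq: "integrable M (\<lambda>\<omega>. (norm (Y \<omega>))\<^sup>2)" for i k Y
    using finite_measure_subalgebra.noise_inner_conditioned(3)[OF fin eM Y moment Y_sq]
      finite_measure_subalgebra.noise_inner_expectation_ge[OF fin prob eM Y mean b moment Y_sq] i
    by blast+
  \<comment> \<open>A constant unit vector as known factor turns the weighted moment bound into a bound on \<open>E \<parallel>e i k\<parallel>\<^sup>2\<close>.\<close>
  have e_sq: "integrable M (\<lambda>\<omega>. (norm (e i k \<omega>))\<^sup>2)" "(\<integral>\<omega>. (norm (e i k \<omega>))\<^sup>2 \<partial>M) \<le> (c k)\<^sup>2"
    if i: "i \<in> {1..m}" for i k
    using finite_measure_subalgebra.noise_inner_conditioned(1,2)[where Y = "\<lambda>_. axis undefined 1",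
        OF fin[OF i, of k] eM[OF i, of k] _ moment[OF i, of k]]
    by (simp_all add: prob_space)
  have x_const: "x k \<omega> = x 0 \<omega>" if "m = 0" "\<omega> \<in> space M" for k \<omega>
    by (induction k) (use x_step z_start that in auto)
  have xX: "x k \<omega> \<in> X" if "\<omega> \<in> space M" for k \<omega>
  proof (cases "m = 0")
    case True
    then show ?thesis using x0_in x_const[OF True that, of k] that by simp
  next
    case False
    then have m: "m \<in> {1..m}" by simp
    show ?thesis
    proof (cases k)
      case (Suc j)
      then show ?thesis
        using x_step z_step[rule_format, OF m that, of j] that closest_point_in_set[OF X(2,1)] by simp
    qed (use x0_in that in simp)
  qed
  have x_G: "x k \<in> borel_measurable (G i k)" if i: "i \<in> {1..m}" for i k
  proof (cases k)
    case 0
    then show ?thesis unfolding G_def by (simp add: measurable_history_initial)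
  next
    case (Suc j)
    have m: "m \<in> {1..m}" using i by auto
    have "z m k \<in> borel_measurable (?H m k)" using z_adapted m Suc by auto
    moreover have "subalgebra (G i k) (?H m k)"
      using i sets_history_subset[of k "Suc k" m m "i - 1" M "x 0" err]
      by (simp add: subalgebra_def G_def space_history)
    ultimately have "z m k \<in> borel_measurable (G i k)" by (rule measurable_from_subalg[rotated])
    moreover have "x k \<omega> = z m k \<omega>" if "\<omega> \<in> space (G i k)" for \<omega>
      using x_step Suc that by (simp add: G_def space_history)
    ultimately show ?thesis using measurable_cong[of "G i k" "x k" "z m k"] by blast
  qed
  from subgrad_bound obtain C' where C': "\<And>i u v. i \<in> {1..m} \<Longrightarrow> u \<in> X \<Longrightarrow> is_subgradient (f i) u v \<Longrightarrow> norm v \<le> C' i"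
    by metis
  define C where "C = (\<Sum>i=1..m. \<bar>C' i\<bar>)"
  have C0: "0 \<le> C" by (simp add: C_def sum_nonneg)
  have C: "norm v \<le> C" if "i \<in> {1..m}" "u \<in> X" "is_subgradient (f i) u v" for i u v
  proof -
    have "\<bar>C' i\<bar> \<le> C" unfolding C_def using that by (intro member_le_sum) auto
    with C'[OF that] show ?thesis by linarith
  qed
  \<comment> \<open>\<open>r k\<close> dominates the quadratic remainder of cycle \<open>k\<close>: by Cauchy-Schwarz and
      \<open>(C + t)\<^sup>2 \<le> 2 (C\<^sup>2 + t\<^sup>2)\<close>, it is at least \<open>3 (a k)\<^sup>2 (\<Sum>i. C + \<parallel>e i k\<parallel>)\<^sup>2\<close>.\<close>
  define r where "r k \<omega> = 3 * (a k)\<^sup>2 * (2 * m * (\<Sum>i=1..m. C\<^sup>2 + (norm (e i k \<omega>))\<^sup>2))" for k \<omega>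
  have r0: "0 \<le> r k \<omega>" for k \<omega> by (simp add: r_def sum_nonneg)
  have descent: "norm (x (Suc k) \<omega> - y)^2 \<le> norm (x k \<omega> - y)^2 - 2 * a k * (ftot (x k \<omega>) - ftot y)
      + (- 2 * (\<Sum>i=1..m. a k * (e i k \<omega> \<bullet> (x k \<omega> - y))) + r k \<omega>)"
    if \<omega>: "\<omega> \<in> space M" and y: "y \<in> X" for k \<omega> y
  proof -
    have "norm (z m (Suc k) \<omega> - y)^2 \<le> norm (z 0 (Suc k) \<omega> - y)^2
      - 2 * a k * ((\<Sum>i=1..m. f i (z 0 (Suc k) \<omega>)) - (\<Sum>i=1..m. f i y))
      - 2 * a k * (\<Sum>i=1..m. e i k \<omega> \<bullet> (z 0 (Suc k) \<omega> - y))
      + 3 * (a k)^2 * (\<Sum>i=1..m. C + norm (e i k \<omega>))^2"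
    proof (rule incremental_cycle_descent[OF X y, where z = "\<lambda>i. z i (Suc k) \<omega>" and g = "\<lambda>i. sg i (Suc k) \<omega>"])
      show "z 0 (Suc k) \<omega> \<in> X" using z_start \<omega> xX[OF \<omega>, of k] by simp
      show "z i (Suc k) \<omega> = closest_point X (z (i - 1) (Suc k) \<omega> - a k *\<^sub>R (sg i (Suc k) \<omega> + e i k \<omega>))"
        if "i \<in> {1..m}" for i
        using z_step that \<omega> by (simp add: a_def e_def)
    qed (use f_convex C C0 a sg \<omega> in auto)
    moreover have "(\<Sum>i=1..m. C + norm (e i k \<omega>))\<^sup>2 \<le> 2 * m * (\<Sum>i=1..m. C\<^sup>2 + (norm (e i k \<omega>))\<^sup>2)"
    proof -
      have "(\<Sum>i=1..m. C + norm (e i k \<omega>))\<^sup>2 \<le> (\<Sum>i=1..m. (C + norm (e i k \<omega>))\<^sup>2) * m"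
        using Cauchy_Schwarz_ineq_sum[of "\<lambda>i. C + norm (e i k \<omega>)" "\<lambda>_. 1" "{1..m}"] by simp
      also have "\<dots> \<le> (\<Sum>i=1..m. 2 * (C\<^sup>2 + (norm (e i k \<omega>))\<^sup>2)) * m"
      proof (intro mult_right_mono sum_mono)
        show "(C + norm (e i k \<omega>))\<^sup>2 \<le> 2 * (C\<^sup>2 + (norm (e i k \<omega>))\<^sup>2)" for i
          using zero_le_power2[of "C - norm (e i k \<omega>)"] by (simp add: power2_sum power2_diff)
      qed simp
      also have "\<dots> = 2 * m * (\<Sum>i=1..m. C\<^sup>2 + (norm (e i k \<omega>))\<^sup>2)"
        unfolding sum_distrib_left[symmetric] by (simp only: ac_simps)
      finally show ?thesis .
    qed
    then have "3 * (a k)\<^sup>2 * (\<Sum>i=1..m. C + norm (e i k \<omega>))\<^sup>2 \<le> r k \<omega>"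
      unfolding r_def by (intro mult_left_mono) auto
    ultimately show ?thesis
      using \<omega> x_step z_start by (simp add: ftot sum_distrib_left sum_negf mult.assoc)
  qed
  have r_int: "integrable M (r k)" for k
    unfolding r_def
    by (intro integrable_mult_right Bochner_Integration.integrable_sum Bochner_Integration.integrable_add e_sq) auto
  define \<rho> where "\<rho> k = 6 * real m * real m * (C\<^sup>2 * (a k)\<^sup>2 + (a k)\<^sup>2 * (c k)\<^sup>2)" for k
  have r_le: "(\<integral>\<omega>. r k \<omega> \<partial>M) \<le> \<rho> k" for k
  proof -
    have "(\<integral>\<omega>. r k \<omega> \<partial>M) = 3 * (a k)\<^sup>2 * (2 * m * (\<Sum>i=1..m. C\<^sup>2 + (\<integral>\<omega>. (norm (e i k \<omega>))\<^sup>2 \<partial>M)))"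
      unfolding r_def using e_sq
      by (simp add: Bochner_Integration.integral_sum prob_space)
    also have "\<dots> \<le> 3 * (a k)\<^sup>2 * (2 * m * (\<Sum>i=1..m. C\<^sup>2 + (c k)\<^sup>2))"
      by (intro mult_left_mono sum_mono add_left_mono e_sq) auto
    also have "\<dots> = \<rho> k" by (simp add: \<rho>_def algebra_simps)
    finally show ?thesis .
  qed
  have \<rho>_sum: "summable \<rho>" unfolding \<rho>_def by (intro summable_mult summable_add aa ac)
  have \<rho>0: "0 \<le> \<rho> k" for k by (simp add: \<rho>_def)
  have r_summable: "AE \<omega> in M. summable (\<lambda>k. r k \<omega>)"
  proof (rule AE_summable_of_summable_integrals[OF r_int])
    show "summable (\<lambda>k. \<integral>\<omega>. r k \<omega> \<partial>M)"
      by (rule summable_comparison_test'[OF \<rho>_sum, of 0]) (use r_le r0 in \<open>simp add: integral_nonneg\<close>)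
  qed (simp add: r0)
  have noise: "AE \<omega> in M. summable (\<lambda>k. a k * (e i k \<omega> \<bullet> Y k \<omega>))"
    if "i \<in> {1..m}" "\<And>k. Y k \<in> borel_measurable (G i k)" "\<And>k. integrable M (\<lambda>\<omega>. (norm (Y k \<omega>))\<^sup>2)"
       "\<And>k. (\<integral>\<omega>. (norm (Y k \<omega>))\<^sup>2 \<partial>M) \<le> D" for i Y D
    by (rule weighted_noise_series_converges[where F = "G i", OF prob G_sub G_mono e_G that(2) mean moment
          a(2) b ab ac that(3,4)]) (use that in auto)
  obtain y0 where y0: "y0 \<in> optimal_set X ftot" using opt_nonempty by blast
  have y0X: "y0 \<in> X" using y0 by (simp add: optimal_set_def)
  have y0_min: "ftot y0 \<le> ftot u" if "u \<in> X" for u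
    using y0 cINF_lower[OF opt_finite that] by (simp add: optimal_set_def)
  \<comment> \<open>The initial vector may fail to be square integrable, so second moments are taken on the event
      \<open>\<parallel>x 0\<parallel> \<le> R\<close>, which belongs to every history; the events exhaust the space as \<open>R\<close> grows.\<close>
  have local: "AE \<omega> in M. norm (x 0 \<omega>) \<le> real R \<longrightarrow>
      (\<forall>i\<in>{1..m}. summable (\<lambda>k. a k * (e i k \<omega> \<bullet> (x k \<omega> - y0))))" for R :: nat
  proof -
    define Y where "Y k \<omega> = (if norm (x 0 \<omega>) \<le> real R then x k \<omega> - y0 else 0)" for k \<omega>
    have Y_G: "Y k \<in> borel_measurable (G i k)" if i: "i \<in> {1..m}" for i k
    proof -
      have [measurable]: "x 0 \<in> borel_measurable (G i k)"
        unfolding G_def by (rule measurable_history_initial)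
      note [measurable] = x_G[OF i, of k]
      show ?thesis unfolding Y_def by measurable
    qed
    have Y_M: "Y k \<in> borel_measurable M" for k
    proof (cases "m = 0")
      case True
      have [measurable]: "x k \<in> borel_measurable M"
        using measurable_cong[of M "x k" "x 0", OF x_const[OF True]] x0_rv by blast
      note [measurable] = x0_rv
      show ?thesis unfolding Y_def by measurable
    next
      case False
      then have m: "m \<in> {1..m}" by simp
      show ?thesis by (rule measurable_from_subalg[OF G_sub[OF m] Y_G[OF m]])
    qed
    define V where "V k \<omega> = (norm (Y k \<omega>))\<^sup>2" for k \<omega>
    have V_M: "V k \<in> borel_measurable M" for k unfolding V_def using Y_M[of k] by measurable
    have V_step: "V (Suc k) \<omega> \<le> V k \<omega> + (- 2 * (\<Sum>i=1..m. a k * (e i k \<omega> \<bullet> Y k \<omega>)) + r k \<omega>)"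
      if \<omega>: "\<omega> \<in> space M" for k \<omega>
    proof (cases "norm (x 0 \<omega>) \<le> real R")
      case True
      have "0 \<le> a k * (ftot (x k \<omega>) - ftot y0)"
        using a y0_min[OF xX[OF \<omega>]] by simp
      with descent[OF \<omega> y0X, of k] True show ?thesis by (simp add: V_def Y_def)
    qed (simp add: V_def Y_def r0)
    have V_int: "integrable M (V k)" for k
    proof (induction k)
      case 0
      show ?case
      proof (rule integrable_const_bound[where B = "(real R + norm y0)\<^sup>2"])
        have "norm (Y 0 \<omega>) \<le> real R + norm y0" for \<omega>
          using norm_triangle_ineq4[of "x 0 \<omega>" y0] by (simp add: Y_def)
        then show "AE \<omega> in M. norm (V 0 \<omega>) \<le> (real R + norm y0)\<^sup>2"
          by (auto simp: V_def intro!: power_mono)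
      qed (rule V_M)
    next
      case (Suc k)
      have Yk: "integrable M (\<lambda>\<omega>. (norm (Y k \<omega>))\<^sup>2)" using Suc by (simp add: V_def[abs_def])
      have "integrable M (\<lambda>\<omega>. V k \<omega> + (- 2 * (\<Sum>i=1..m. a k * (e i k \<omega> \<bullet> Y k \<omega>)) + r k \<omega>))"
        by (intro Bochner_Integration.integrable_add Suc integrable_mult_right
            Bochner_Integration.integrable_sum r_int cond(1) Y_G Yk)
      then show ?case
      proof (rule Bochner_Integration.integrable_bound[OF _ V_M])
        show "AE \<omega> in M. norm (V (Suc k) \<omega>)
            \<le> norm (V k \<omega> + (- 2 * (\<Sum>i=1..m. a k * (e i k \<omega> \<bullet> Y k \<omega>)) + r k \<omega>))"
        proof (rule AE_I2)
          fix \<omega> assume "\<omega> \<in> space M"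
          moreover have "0 \<le> V (Suc k) \<omega>" by (simp add: V_def)
          ultimately show "norm (V (Suc k) \<omega>)
            \<le> norm (V k \<omega> + (- 2 * (\<Sum>i=1..m. a k * (e i k \<omega> \<bullet> Y k \<omega>)) + r k \<omega>))"
            using V_step[of \<omega> k] unfolding real_norm_def by linarith
        qed
      qed
    qed
    have Y_sq: "integrable M (\<lambda>\<omega>. (norm (Y k \<omega>))\<^sup>2)" for k using V_int[of k] by (simp add: V_def[abs_def])
    \<comment> \<open>Boundedness in mean square: the bias enters the recursion for \<open>E (V k)\<close> with summable coefficients.\<close>
    define w where "w k = (\<integral>\<omega>. V k \<omega> \<partial>M)" for k
    have w_step: "w (Suc k) \<le> (1 + 2 * real m * (a k * b k)) * w k + (2 * real m * (a k * b k) + \<rho> k)" for k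
    proof -
      let ?N = "\<lambda>\<omega>. \<Sum>i=1..m. a k * (e i k \<omega> \<bullet> Y k \<omega>)"
      have N_int: "integrable M ?N"
        by (intro integrable_mult_right Bochner_Integration.integrable_sum cond(1) Y_G Y_sq)
      have "w (Suc k) \<le> (\<integral>\<omega>. V k \<omega> + (- 2 * ?N \<omega> + r k \<omega>) \<partial>M)"
        unfolding w_def
        by (intro integral_mono V_int Bochner_Integration.integrable_add integrable_mult_right N_int r_int V_step)
      also have "\<dots> = w k - 2 * (\<integral>\<omega>. ?N \<omega> \<partial>M) + (\<integral>\<omega>. r k \<omega> \<partial>M)"
        using V_int[of k] N_int r_int[of k] unfolding w_def by simp
      also have "(\<integral>\<omega>. ?N \<omega> \<partial>M) = (\<Sum>i=1..m. a k * (\<integral>\<omega>. e i k \<omega> \<bullet> Y k \<omega> \<partial>M))"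
        by (subst Bochner_Integration.integral_sum)
           (auto intro!: integrable_mult_right cond(1) Y_G Y_sq)
      finally have "w (Suc k) \<le> w k + 2 * (\<Sum>i=1..m. a k * - (\<integral>\<omega>. e i k \<omega> \<bullet> Y k \<omega> \<partial>M)) + (\<integral>\<omega>. r k \<omega> \<partial>M)"
        by (simp add: sum_negf)
      moreover have "(\<Sum>i=1..m. a k * - (\<integral>\<omega>. e i k \<omega> \<bullet> Y k \<omega> \<partial>M)) \<le> (\<Sum>i=1..m. a k * (b k * (1 + w k)))"
        unfolding w_def V_def by (intro sum_mono mult_left_mono cond(2) Y_G Y_sq a)
      ultimately show ?thesis using r_le[of k] by (simp add: algebra_simps)
    qed
    have "\<exists>D. \<forall>k. w k \<le> D"
    proof (rule discrete_gronwall_bounded[where a = w and p = "\<lambda>k. 2 * real m * (a k * b k)", OF w_step])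
      show "0 \<le> w k" for k by (simp add: w_def V_def)
      show "summable (\<lambda>k. 2 * real m * (a k * b k))" by (intro summable_mult ab)
      then show "summable (\<lambda>k. 2 * real m * (a k * b k) + \<rho> k)" by (intro summable_add \<rho>_sum)
    qed (simp_all add: a b \<rho>0)
    then obtain D where D: "\<And>k. w k \<le> D" by blast
    have "AE \<omega> in M. summable (\<lambda>k. a k * (e i k \<omega> \<bullet> Y k \<omega>))" if i: "i \<in> {1..m}" for i
      by (rule noise[OF i Y_G[OF i] Y_sq]) (use D in \<open>simp add: w_def V_def\<close>)
    then have "AE \<omega> in M. \<forall>i\<in>{1..m}. summable (\<lambda>k. a k * (e i k \<omega> \<bullet> Y k \<omega>))"
      by (intro AE_finite_allI) auto
    then show ?thesis by eventually_elim (auto simp: Y_def)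
  qed
  have "AE \<omega> in M. \<forall>R::nat. norm (x 0 \<omega>) \<le> real R \<longrightarrow>
      (\<forall>i\<in>{1..m}. summable (\<lambda>k. a k * (e i k \<omega> \<bullet> (x k \<omega> - y0))))"
    unfolding AE_all_countable by (intro allI local)
  then have noise_y0: "AE \<omega> in M. \<forall>i\<in>{1..m}. summable (\<lambda>k. a k * (e i k \<omega> \<bullet> (x k \<omega> - y0)))"
    by eventually_elim (metis real_arch_simple)
  \<comment> \<open>The inner products with all other optimal points differ from those with \<open>y0\<close> by fixed linear
      combinations of the coordinate series; so one null set serves all optimal points at once.\<close>
  have noise_axis: "AE \<omega> in M. \<forall>i\<in>{1..m}. \<forall>j. summable (\<lambda>k. a k * e i k \<omega> $ j)"
  proof (intro AE_finite_allI)
    fix i assume i: "i \<in> {1..m}"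
    have "AE \<omega> in M. summable (\<lambda>k. a k * e i k \<omega> $ j)" for j
      using noise[OF i, of "\<lambda>_ _. axis j 1" 1] by (simp add: inner_axis prob_space)
    then have "AE \<omega> in M. \<forall>j\<in>UNIV. summable (\<lambda>k. a k * e i k \<omega> $ j)"
      by (intro AE_finite_allI) auto
    then show "AE \<omega> in M. \<forall>j. summable (\<lambda>k. a k * e i k \<omega> $ j)" by simp
  qed simp
  have ftot_cont: "continuous_on UNIV ftot"
    unfolding ftot by (intro continuous_on_sum convex_on_continuous) (use f_convex in auto)
  have "AE \<omega> in M. \<omega> \<in> space M" by simp
  with noise_y0 noise_axis r_summable show ?thesis
  proof eventually_elim
    case (elim \<omega>)
    show ?case
    proof (rule quasi_fejer_converges_to_optimal[OF X(2) xX[OF elim(4)] ftot_cont opt_finite opt_nonempty,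
          where b = "\<lambda>k. 2 * a k"
            and c = "\<lambda>y k. - 2 * (\<Sum>i=1..m. a k * (e i k \<omega> \<bullet> (x k \<omega> - y))) + r k \<omega>"])
      show "0 < 2 * a k" for k using a by simp
      show "\<not> summable (\<lambda>k. 2 * a k)" using a_inf by (simp add: summable_cmult_iff)
    next
      fix y k assume "y \<in> optimal_set X ftot"
      then have "y \<in> X" by (simp add: optimal_set_def)
      then show "norm (x (Suc k) \<omega> - y)^2 \<le> norm (x k \<omega> - y)^2 - 2 * a k * (ftot (x k \<omega>) - ftot y)
          + (- 2 * (\<Sum>i=1..m. a k * (e i k \<omega> \<bullet> (x k \<omega> - y))) + r k \<omega>)"
        by (rule descent[OF elim(4)])
    next
      fix y assume "y \<in> optimal_set X ftot"
      have "summable (\<lambda>k. a k * (e i k \<omega> \<bullet> (x k \<omega> - y)))" if i: "i \<in> {1..m}" for i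
      proof -
        have "(\<lambda>k. a k * (e i k \<omega> \<bullet> (x k \<omega> - y)))
          = (\<lambda>k. a k * (e i k \<omega> \<bullet> (x k \<omega> - y0)) + (\<Sum>j\<in>UNIV. (a k * e i k \<omega> $ j) * (y0 - y) $ j))"
        proof
          fix k
          have "(\<Sum>j\<in>UNIV. (a k * e i k \<omega> $ j) * (y0 - y) $ j) = a k * (e i k \<omega> \<bullet> (y0 - y))"
            by (simp add: inner_vec_def sum_distrib_left mult.assoc)
          then show "a k * (e i k \<omega> \<bullet> (x k \<omega> - y))
            = a k * (e i k \<omega> \<bullet> (x k \<omega> - y0)) + (\<Sum>j\<in>UNIV. (a k * e i k \<omega> $ j) * (y0 - y) $ j)"
            by (simp only: inner_diff_right) (simp add: algebra_simps)
        qed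
        moreover have "summable (\<lambda>k. a k * (e i k \<omega> \<bullet> (x k \<omega> - y0))
            + (\<Sum>j\<in>UNIV. (a k * e i k \<omega> $ j) * (y0 - y) $ j))"
          using elim(1,2) i by (intro summable_add summable_sum summable_mult2) auto
        ultimately show ?thesis by simp
      qed
      then show "summable (\<lambda>k. - 2 * (\<Sum>i=1..m. a k * (e i k \<omega> \<bullet> (x k \<omega> - y))) + r k \<omega>)"
        by (intro summable_add summable_mult summable_sum elim(3)) auto
    qed
  qed
qed

end
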